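(* Let $\beta>0$ and $\epsilon>0$. In the singly periodic setting (cell $\mathcal{C}_1$, $k=1$) and the doubly periodic setting (cell $\mathcal{C}_2$, $k=2$) let $\{w_{n,\beta,k},\lambda_{n,\beta,k}\}_{n=1}^{N_q^k(\beta)}$ and $\{w_{n,0,k},\lambda_{n,0,k}\}_{n=1}^{N_q^k(0)}$ be quadratures of precision $\epsilon$ for the two integrals representing $\mathbf{K}_k^{west}$ (as defined in the context). Let $\mathbf{s}_j=(x'_j,y'_j)$, $j=1,\dots,N_S$, and $\mathbf{t}_l=(x_l,y_l)$, $l=1,\dots,N_T$, be sources and targets in the unit cell. Put $\sigma_{n,k}=\sqrt{\lambda_{n,\beta,k}^2+\beta^2}$ and let $\mathbf{I}_2$ be the $2\times2$ identity. For $k=1,2$ define block matrices with $2\times2$ blocks $$\mathbf{L}_{k,\beta}^{west}(l,n)=e^{-\sigma_{n,k}x_l}e^{i\lambda_{n,\beta,k}y_l}\mathbf{I}_2,\qquad \mathbf{L}_k^{west}(l,n)=e^{-|\lambda_{n,0,k}|x_l}e^{i\lambda_{n,0,k}y_l}\mathbf{I}_2,$$ $$\mathbf{R}_{k,\beta}^{west}(n,j)=e^{\sigma_{n,k}x'_j}e^{-i\lambda_{n,\beta,k}y'_j}\mathbf{I}_2,\qquad \mathbf{R}_k^{west}(n,j)=e^{|\lambda_{n,0,k}|x'_j}e^{-i\lambda_{n,0,k}y'_j}\mathbf{I}_2,$$ and block diagonal matrices with $2\times2$ diagonal blocks $$\mathbf{D}_{1,\beta}^{west}(n,n)=\frac{w_{n,\beta,1}}{4\pi\beta^2}\frac{e^{-2\sigma_{n,1}d}}{1-e^{-\sigma_{n,1}d}}\begin{bmatrix}-\frac{\lambda_{n,\beta,1}^2}{\sigma_{n,1}}&i\lambda_{n,\beta,1}\\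 i\lambda_{n,\beta,1}&\sigma_{n,1}\end{bmatrix},$$ $$\mathbf{D}_1^{west}(n,n)=\frac{w_{n,0,1}}{4\pi\beta^2}\frac{e^{-2|\lambda_{n,0,1}|d}}{1-e^{-|\lambda_{n,0,1}|d}}\begin{bmatrix}|\lambda_{n,0,1}|&-i\lambda_{n,0,1}\\ -i\lambda_{n,0,1}&-|\lambda_{n,0,1}|\end{bmatrix},$$ $$\mathbf{D}_{2,\beta}^{west}(n,n)=\frac{w_{n,\beta,2}}{4\pi\beta^2}\left[e^{-\sigma_{n,2}\xi+i\lambda_{n,\beta,2}\eta}+e^{\sigma_{n,2}\xi-i\lambda_{n,\beta,2}\eta}+1\right]\frac{e^{-4\sigma_{n,2}d}}{1-e^{-\sigma_{n,2}d}}\begin{bmatrix}-\frac{\lambda_{n,\beta,2}^2}{\sigma_{n,2}}&i\lambda_{n,\beta,2}\\ i\lambda_{n,\beta,2}&\sigma_{n,2}\end{bmatrix},$$ $$\mathbf{D}_2^{west}(n,n)=\frac{w_{n,0,2}}{4\pi\beta^2}\left[e^{-|\lambda_{n,0,2}|\xi+i\lambda_{n,0,2}\eta}+e^{|\lambda_{n,0,2}|\xi-i\lambda_{n,0,2}\eta}+1\right]\frac{e^{-4|\lambda_{n,0,2}|d}}{1-e^{-|\lambda_{n,0,2}|d}}\begin{bmatrix}|\lambda_{n,0,2}|&-i\lambda_{n,0,2}\\ -i\lambda_{n,0,2}&-|\lambda_{n,0,2}|\end{bmatrix}.$$ Let $\mathbf{P}_k^{west}=\mathbf{L}_{k,\beta}^{west}\mathbf{D}_{k,\beta}^{west}\mathbf{R}_{k,\beta}^{west}+\mathbf{L}_k^{west}\mathbf{D}_k^{west}\mathbf{R}_k^{west}$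 for $k=1,2$. Let $\mathbf{P}_k^{east}$ be defined by the same formulas except that $x_l$ is replaced by $-x_l$ in all $\mathbf{L}$ blocks, $x'_j$ is replaced by $-x'_j$ in all $\mathbf{R}$ blocks, and every $\mathbf{D}$ block is replaced by its complex conjugate. Then for every $\mathbf{q}=(\mathbf{q}_1,\dots,\mathbf{q}_{N_S})$, $\mathbf{q}_j=(q_{j,1},q_{j,2})\in\mathbb{R}^2$, the real parts of $\mathbf{P}_k^{west}\mathbf{q}$ and $\mathbf{P}_k^{east}\mathbf{q}$ give, to precision $O(\epsilon)$, the contributions of the west and east image sources to the corresponding modified Stokes periodizing potentials: for $k=1,2$, $\ast\in\{west,east\}$ and every $l$, each of the two components of $$\operatorname{Re}\left(\mathbf{P}_k^{\ast}\mathbf{q}\right)_l-\sum_{j=1}^{N_S}\mathbf{K}_k^{\ast}(\mathbf{t}_l,\mathbf{s}_j)\,\mathbf{q}_j$$ is bounded in absolute value by $2\epsilon\sum_{j=1}^{N_S}(|q_{j,1}|+|q_{j,2}|)$.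
   Context: Modified Stokeslet: for $\mathbf{t}=(x,y)\ne0$, $$\mathbf{G}^{(\mathrm{MS})}(\mathbf{t})=\begin{pmatrix}-\partial_{yy}&\partial_{xy}\\ \partial_{xy}&-\partial_{xx}\end{pmatrix}G_{\mathrm{MB}}(\mathbf{t}),\qquad G_{\mathrm{MB}}(\mathbf{t})=-\frac{1}{2\pi\beta^2}\left[K_0(\beta|\mathbf{t}|)-\log(1/|\mathbf{t}|)\right],$$ with $K_0$ the modified Bessel function of the second kind. Singly periodic setting: $d,\eta>0$, $\mathcal{C}_1=[-\tfrac d2,\tfrac d2]\times[-\tfrac\eta2,\tfrac\eta2]$, $\mathbf{K}_1^{west}(\mathbf{t},\mathbf{s})=\sum_{m=-\infty}^{-2}\mathbf{G}^{(\mathrm{MS})}(\mathbf{t}-\mathbf{s}-(md,0))$, and $\mathbf{K}_1^{east}$ is the same sum over $m\ge2$. Doubly periodic setting: $d,\eta>0$, $\xi\in\mathbb{R}$, $d\ge\sqrt{\xi^2+\eta^2}$, $\mathbf{e}_1=(d,0)$, $\mathbf{e}_2=(\xi,\eta)$, $\mathcal{C}_2=\{x_1\mathbf{e}_1+x_2\mathbf{e}_2 : x_1,x_2\in[-\tfrac12,\tfrac12]\}$, $\mathbf{l}_{mn}=m\mathbf{e}_1+n\mathbf{e}_2$, $\mathbf{K}_2^{west}(\mathbf{t},\mathbf{s})=\sum_{m=-\infty}^{-4}\sum_{n=-1}^{1}\mathbf{G}^{(\mathrm{MS})}(\mathbf{t}-\mathbf{s}-\mathbf{l}_{mn})$, and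 $\mathbf{K}_2^{east}$ is the same sum over $m\ge4$. The two integrals: for real $\lambda\ne 0$ and a number $\sigma>0$ let $B(\sigma,\lambda)=e^{-\sigma\xi+i\lambda\eta}+e^{\sigma\xi-i\lambda\eta}+1$, and put $a_1(\sigma,\lambda)=\frac{e^{-2\sigma d}}{1-e^{-\sigma d}}$, $a_2(\sigma,\lambda)=\frac{e^{-4\sigma d}}{1-e^{-\sigma d}}B(\sigma,\lambda)$. With $\mathbf{t}=(x,y)$, $\mathbf{s}=(x',y')$, and $\sigma=\sqrt{\lambda^2+\beta^2}$, let $$\mathbf{F}_{k,\beta}(\lambda;\mathbf{t},\mathbf{s})=\frac{a_k(\sigma,\lambda)}{4\pi\beta^2}e^{-\sigma(x-x')}e^{i\lambda(y-y')}\begin{bmatrix}-\lambda^2/\sigma&i\lambda\\ i\lambda&\sigma\end{bmatrix},$$ $$\mathbf{F}_{k,0}(\lambda;\mathbf{t},\mathbf{s})=\frac{a_k(|\lambda|,\lambda)}{4\pi\beta^2}e^{-|\lambda|(x-x')}e^{i\lambda(y-y')}\begin{bmatrix}|\lambda|&-i\lambda\\ -i\lambda&-|\lambda|\end{bmatrix}.$$ Real weights and nonzero real nodes $\{w_{n,\gamma,k},\lambda_{n,\gamma,k}\}$, $n=1,\dots,N_q^k(\gamma)$ ($\gamma=\beta$ or $0$) form a quadrature of precision $\epsilon$ if every entry of $\operatorname{Re}\int_{-\infty}^{\infty}\mathbf{F}_{k,\gamma}(\lambda;\mathbf{t},\mathbf{s})\,d\lambda-\operatorname{Re}\sum_n w_{n,\gamma,k}\mathbf{F}_{k,\gamma}(\lambda_{n,\gamma,k};\mathbf{t},\mathbf{s})$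 is at most $\epsilon$ in absolute value for all $\mathbf{t},\mathbf{s}\in\mathcal{C}_k$. *)

theory Defs
  imports "HOL-Analysis.Analysis"
begin

section \<open>The modified Stokeslet\<close>

(* Modified Bessel function of the second kind, by its standard integral
   representation; valid for z > 0, the only arguments that occur. *)
definition bessel_K :: "real \<Rightarrow> real \<Rightarrow> real" where
  "bessel_K \<nu> z = (LBINT u:{0..}. exp (- z * cosh u) * cosh (\<nu> * u))"

definition partial_x :: "(real \<times> real \<Rightarrow> real) \<Rightarrow> real \<times> real \<Rightarrow> real" where
  "partial_x f p = deriv (\<lambda>u. f (u, snd p)) (fst p)"

definition partial_y :: "(real \<times> real \<Rightarrow> real) \<Rightarrow> real \<times> real \<Rightarrow> real" where
  "partial_y f p = deriv (\<lambda>v. f (fst p, v)) (snd p)"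

definition G_MB :: "real \<Rightarrow> real \<times> real \<Rightarrow> real" where
  "G_MB \<beta> t = - (1 / (2 * pi * \<beta>\<^sup>2)) * (bessel_K 0 (\<beta> * norm t) - ln (1 / norm t))"

(* Meaningful for t \<noteq> 0 only. *)
definition G_MS :: "real \<Rightarrow> real \<times> real \<Rightarrow> real^2^2" where
  "G_MS \<beta> t = vector
     [vector [- partial_y (partial_y (G_MB \<beta>)) t, partial_x (partial_y (G_MB \<beta>)) t],
      vector [partial_x (partial_y (G_MB \<beta>)) t, - partial_x (partial_x (G_MB \<beta>)) t]]"


section \<open>Periodic settings and far image sums\<close>

datatype setting = Singly | Doubly

datatype side = West | East

fun admissible :: "setting \<Rightarrow> real \<Rightarrow> real \<Rightarrow> real \<Rightarrow> bool" where
  "admissible Singly d \<xi> \<eta> \<longleftrightarrow> d > 0 \<and> \<eta> > 0"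
| "admissible Doubly d \<xi> \<eta> \<longleftrightarrow> d > 0 \<and> \<eta> > 0 \<and> d \<ge> sqrt (\<xi>\<^sup>2 + \<eta>\<^sup>2)"

(* The parameter \<xi> plays no role in the singly periodic setting. *)
fun cell :: "setting \<Rightarrow> real \<Rightarrow> real \<Rightarrow> real \<Rightarrow> (real \<times> real) set" where
  "cell Singly d \<xi> \<eta> = {- d / 2 .. d / 2} \<times> {- \<eta> / 2 .. \<eta> / 2}"
| "cell Doubly d \<xi> \<eta> =
     {x1 *\<^sub>R (d, 0) + x2 *\<^sub>R (\<xi>, \<eta>) | x1 x2. x1 \<in> {- 1/2 .. 1/2} \<and> x2 \<in> {- 1/2 .. 1/2}}"

definition lattice_point :: "real \<Rightarrow> real \<Rightarrow> real \<Rightarrow> int \<Rightarrow> int \<Rightarrow> real \<times> real" where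
  "lattice_point d \<xi> \<eta> m n = of_int m *\<^sub>R (d, 0) + of_int n *\<^sub>R (\<xi>, \<eta>)"

fun far_indices :: "setting \<Rightarrow> side \<Rightarrow> int set" where
  "far_indices Singly West = {..-2}"
| "far_indices Singly East = {2..}"
| "far_indices Doubly West = {..-4}"
| "far_indices Doubly East = {4..}"

fun K_far :: "setting \<Rightarrow> side \<Rightarrow> real \<Rightarrow> real \<Rightarrow> real \<Rightarrow> real \<Rightarrow>
    real \<times> real \<Rightarrow> real \<times> real \<Rightarrow> real^2^2" where
  "K_far Singly a d \<xi> \<eta> \<beta> t s =
     (\<Sum>\<^sub>\<infinity>m\<in>far_indices Singly a. G_MS \<beta> (t - s - (of_int m * d, 0)))"
| "K_far Doubly a d \<xi> \<eta> \<beta> t s =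
     (\<Sum>\<^sub>\<infinity>m\<in>far_indices Doubly a. \<Sum>n=-1..1. G_MS \<beta> (t - s - lattice_point d \<xi> \<eta> m n))"


section \<open>The two integrals and their quadratures\<close>

definition decay_rate :: "real \<Rightarrow> real \<Rightarrow> real" where
  "decay_rate \<beta> l = sqrt (l\<^sup>2 + \<beta>\<^sup>2)"

definition B_factor :: "real \<Rightarrow> real \<Rightarrow> real \<Rightarrow> real \<Rightarrow> complex" where
  "B_factor \<xi> \<eta> \<sigma> l =
     exp (- of_real (\<sigma> * \<xi>) + \<i> * of_real (l * \<eta>)) +
     exp (of_real (\<sigma> * \<xi>) - \<i> * of_real (l * \<eta>)) + 1"

fun a_factor :: "setting \<Rightarrow> real \<Rightarrow> real \<Rightarrow> real \<Rightarrow> real \<Rightarrow> real \<Rightarrow> complex" where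
  "a_factor Singly d \<xi> \<eta> \<sigma> l = of_real (exp (- 2 * \<sigma> * d) / (1 - exp (- \<sigma> * d)))"
| "a_factor Doubly d \<xi> \<eta> \<sigma> l =
     of_real (exp (- 4 * \<sigma> * d) / (1 - exp (- \<sigma> * d))) * B_factor \<xi> \<eta> \<sigma> l"

definition scale_matrix :: "complex \<Rightarrow> complex^2^2 \<Rightarrow> complex^2^2" where
  "scale_matrix c A = map_matrix ((*) c) A"

definition M_beta :: "real \<Rightarrow> real \<Rightarrow> complex^2^2" where
  "M_beta \<beta> l = vector
     [vector [of_real (- l\<^sup>2 / decay_rate \<beta> l), \<i> * of_real l],
      vector [\<i> * of_real l, of_real (decay_rate \<beta> l)]]"

definition M_zero :: "real \<Rightarrow> complex^2^2" where
  "M_zero l = vector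
     [vector [of_real \<bar>l\<bar>, - \<i> * of_real l],
      vector [- \<i> * of_real l, - of_real \<bar>l\<bar>]]"

definition F_beta :: "setting \<Rightarrow> real \<Rightarrow> real \<Rightarrow> real \<Rightarrow> real \<Rightarrow> real \<Rightarrow>
    real \<times> real \<Rightarrow> real \<times> real \<Rightarrow> complex^2^2" where
  "F_beta k d \<xi> \<eta> \<beta> l t s = scale_matrix
     (a_factor k d \<xi> \<eta> (decay_rate \<beta> l) l / of_real (4 * pi * \<beta>\<^sup>2) *
      of_real (exp (- decay_rate \<beta> l * (fst t - fst s))) *
      exp (\<i> * of_real (l * (snd t - snd s))))
     (M_beta \<beta> l)"

definition F_zero :: "setting \<Rightarrow> real \<Rightarrow> real \<Rightarrow> real \<Rightarrow> real \<Rightarrow> real \<Rightarrow>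
    real \<times> real \<Rightarrow> real \<times> real \<Rightarrow> complex^2^2" where
  "F_zero k d \<xi> \<eta> \<beta> l t s = scale_matrix
     (a_factor k d \<xi> \<eta> \<bar>l\<bar> l / of_real (4 * pi * \<beta>\<^sup>2) *
      of_real (exp (- \<bar>l\<bar> * (fst t - fst s))) *
      exp (\<i> * of_real (l * (snd t - snd s))))
     (M_zero l)"

(* Nodes and weights are families over a finite index type, so repeated nodes are allowed. *)
definition quadrature_of_precision ::
    "real \<Rightarrow> (real \<times> real) set \<Rightarrow>
     (real \<Rightarrow> real \<times> real \<Rightarrow> real \<times> real \<Rightarrow> complex^2^2) \<Rightarrow>
     ('n::finite \<Rightarrow> real) \<Rightarrow> ('n \<Rightarrow> real) \<Rightarrow> bool" where
  "quadrature_of_precision \<epsilon> C F w node \<longleftrightarrow>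
     (\<forall>n. node n \<noteq> 0) \<and>
     (\<forall>t\<in>C. \<forall>s\<in>C. \<forall>i j.
        \<bar>Re ((LINT l|lborel. F l t s) $ i $ j) -
         Re ((\<Sum>n\<in>UNIV. w n *\<^sub>R F (node n) t s) $ i $ j)\<bar> \<le> \<epsilon>)"


section \<open>The factored matrices\<close>

(* A matrix of 2 x 2 blocks is an ordinary matrix whose rows and columns are indexed
   by pairs (block index, index within the block). *)
definition block_matrix :: "('m \<Rightarrow> 'n \<Rightarrow> complex^2^2) \<Rightarrow> complex^('n::finite \<times> 2)^('m::finite \<times> 2)" where
  "block_matrix A = (\<chi> p q. A (fst p) (fst q) $ snd p $ snd q)"

definition block_diagonal :: "('n \<Rightarrow> complex^2^2) \<Rightarrow> complex^('n::finite \<times> 2)^('n \<times> 2)" where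
  "block_diagonal A = block_matrix (\<lambda>m n. if m = n then A n else 0)"

definition block_vector :: "('n \<Rightarrow> real^2) \<Rightarrow> complex^('n::finite \<times> 2)" where
  "block_vector q = (\<chi> p. of_real (q (fst p) $ snd p))"

(* The decay rate \<sigma> is sqrt (node^2 + \<beta>^2) or the absolute value of the node. *)
definition L_matrix :: "('n::finite \<Rightarrow> real) \<Rightarrow> ('n \<Rightarrow> real) \<Rightarrow> ('t::finite \<Rightarrow> real \<times> real) \<Rightarrow>
    complex^('n \<times> 2)^('t \<times> 2)" where
  "L_matrix \<sigma> node t = block_matrix (\<lambda>l n. scale_matrix
     (of_real (exp (- \<sigma> n * fst (t l))) * exp (\<i> * of_real (node n * snd (t l)))) (mat 1))"

definition R_matrix :: "('n::finite \<Rightarrow> real) \<Rightarrow> ('n \<Rightarrow> real) \<Rightarrow> ('s::finite \<Rightarrow> real \<times> real) \<Rightarrow>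
    complex^('s \<times> 2)^('n \<times> 2)" where
  "R_matrix \<sigma> node s = block_matrix (\<lambda>n j. scale_matrix
     (of_real (exp (\<sigma> n * fst (s j))) * exp (- \<i> * of_real (node n * snd (s j)))) (mat 1))"

definition D_beta :: "setting \<Rightarrow> real \<Rightarrow> real \<Rightarrow> real \<Rightarrow> real \<Rightarrow>
    ('n::finite \<Rightarrow> real) \<Rightarrow> ('n \<Rightarrow> real) \<Rightarrow> complex^('n \<times> 2)^('n \<times> 2)" where
  "D_beta k d \<xi> \<eta> \<beta> w node = block_diagonal (\<lambda>n. scale_matrix
     (of_real (w n / (4 * pi * \<beta>\<^sup>2)) * a_factor k d \<xi> \<eta> (decay_rate \<beta> (node n)) (node n))
     (M_beta \<beta> (node n)))"

definition D_zero :: "setting \<Rightarrow> real \<Rightarrow> real \<Rightarrow> real \<Rightarrow> real \<Rightarrow>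
    ('n::finite \<Rightarrow> real) \<Rightarrow> ('n \<Rightarrow> real) \<Rightarrow> complex^('n \<times> 2)^('n \<times> 2)" where
  "D_zero k d \<xi> \<eta> \<beta> w node = block_diagonal (\<lambda>n. scale_matrix
     (of_real (w n / (4 * pi * \<beta>\<^sup>2)) * a_factor k d \<xi> \<eta> \<bar>node n\<bar> (node n))
     (M_zero (node n)))"

definition reflect_x :: "real \<times> real \<Rightarrow> real \<times> real" where
  "reflect_x p = (- fst p, snd p)"

fun P_matrix :: "setting \<Rightarrow> side \<Rightarrow> real \<Rightarrow> real \<Rightarrow> real \<Rightarrow> real \<Rightarrow>
    ('n::finite \<Rightarrow> real) \<Rightarrow> ('n \<Rightarrow> real) \<Rightarrow> ('m::finite \<Rightarrow> real) \<Rightarrow> ('m \<Rightarrow> real) \<Rightarrow>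
    ('t::finite \<Rightarrow> real \<times> real) \<Rightarrow> ('s::finite \<Rightarrow> real \<times> real) \<Rightarrow>
    complex^('s \<times> 2)^('t \<times> 2)" where
  "P_matrix k West d \<xi> \<eta> \<beta> w\<beta> node\<beta> w0 node0 t s =
     L_matrix (\<lambda>n. decay_rate \<beta> (node\<beta> n)) node\<beta> t ** D_beta k d \<xi> \<eta> \<beta> w\<beta> node\<beta> **
       R_matrix (\<lambda>n. decay_rate \<beta> (node\<beta> n)) node\<beta> s +
     L_matrix (\<lambda>n. \<bar>node0 n\<bar>) node0 t ** D_zero k d \<xi> \<eta> \<beta> w0 node0 **
       R_matrix (\<lambda>n. \<bar>node0 n\<bar>) node0 s"
| "P_matrix k East d \<xi> \<eta> \<beta> w\<beta> node\<beta> w0 node0 t s =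
     L_matrix (\<lambda>n. decay_rate \<beta> (node\<beta> n)) node\<beta> (reflect_x \<circ> t) **
       map_matrix cnj (D_beta k d \<xi> \<eta> \<beta> w\<beta> node\<beta>) **
       R_matrix (\<lambda>n. decay_rate \<beta> (node\<beta> n)) node\<beta> (reflect_x \<circ> s) +
     L_matrix (\<lambda>n. \<bar>node0 n\<bar>) node0 (reflect_x \<circ> t) **
       map_matrix cnj (D_zero k d \<xi> \<eta> \<beta> w0 node0) **
       R_matrix (\<lambda>n. \<bar>node0 n\<bar>) node0 (reflect_x \<circ> s)"

end

theory Submission
  imports Defs "HOL-Real_Asymp.Real_Asymp"
begin

text \<open>
  For \<open>x > 0\<close> every entry of the modified Stokeslet is the real part of a superposition of plane
  waves \<open>exp (- \<sigma> x + \<i> l y)\<close>. With \<open>\<sigma> = sqrt (l\<^sup>2 + \<beta>\<^sup>2)\<close> this comes from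
  \<open>2 K\<^sub>0 (\<beta> r) = \<integral> exp (- \<sigma> x + \<i> l y) / \<sigma> dl\<close>, differentiated under the integral sign; the logarithmic
  part is the case \<open>\<sigma> = \<bar>l\<bar>\<close>, where the differentiated integrals are elementary. Shifting \<open>x\<close>
  by multiples of \<open>d\<close> multiplies the integrand by powers of \<open>exp (- \<sigma> d)\<close>, so the image sum is a
  geometric series under the integral, which produces the factors \<open>a\<^sub>k\<close>. The factored matrices reproduce
  the quadrature sum of the integrand entry by entry, and each of the two integrals contributes an
  error of at most \<open>\<epsilon>\<close>. Since the Stokeslet is even, the east sum at \<open>(t, s)\<close> is the west sum at
  \<open>(s, t)\<close>, and conjugation does the same for the factored matrices.
\<close>

section \<open>Differentiation under the integral sign\<close>

text \<open>Mean value inequality; it turns a bound on the derivative into a bound on difference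
  quotients.\<close>

lemma vector_derivative_bound:
  fixes f :: "real \<Rightarrow> 'b::real_normed_vector"
  assumes "convex S" and "\<And>q. q \<in> S \<Longrightarrow> (f has_vector_derivative f' q) (at q within S)"
    and "\<And>q. q \<in> S \<Longrightarrow> norm (f' q) \<le> B" and "a \<in> S" "b \<in> S"
  shows "norm (f a - f b) \<le> B * \<bar>a - b\<bar>"
proof -
  have "norm (f a - f b) \<le> B * norm (a - b)"
  proof (rule differentiable_bound[OF assms(1)])
    show "(f has_derivative (\<lambda>h. h *\<^sub>R f' q)) (at q within S)" if "q \<in> S" for q
      using assms(2)[OF that] by (simp add: has_vector_derivative_def)
    show "onorm (\<lambda>h. h *\<^sub>R f' q) \<le> B" if "q \<in> S" for q
      using assms(3)[OF that]
      by (intro onorm_le) (auto simp: mult.commute[of B] intro!: mult_left_mono)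
  qed (use assms in auto)
  then show ?thesis by simp
qed

text \<open>Difference quotients replace the remainder of the linear approximation, because they are
  what dominated convergence is applied to.\<close>

lemma has_vector_derivative_iff_tendsto:
  fixes f :: "real \<Rightarrow> 'b::real_normed_vector"
  shows "(f has_vector_derivative D) (at p within U) \<longleftrightarrow>
    ((\<lambda>q. (f q - f p) /\<^sub>R (q - p)) \<longlongrightarrow> D) (at p within U)"
proof -
  have "norm ((1 / norm (q - p)) *\<^sub>R (f q - (f p + (q - p) *\<^sub>R D))) = norm ((f q - f p) /\<^sub>R (q - p) - D)"
    if "q \<noteq> p" for q
  proof -
    have "(f q - f p) /\<^sub>R (q - p) - D = (f q - (f p + (q - p) *\<^sub>R D)) /\<^sub>R (q - p)"
      using that by (simp add: scaleR_diff_right flip: diff_diff_eq)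
    then show ?thesis by (simp add: divide_inverse abs_inverse)
  qed
  then have "((\<lambda>q. norm ((1 / norm (q - p)) *\<^sub>R (f q - (f p + (q - p) *\<^sub>R D)))) \<longlongrightarrow> 0) (at p within U) \<longleftrightarrow>
      ((\<lambda>q. norm ((f q - f p) /\<^sub>R (q - p) - D)) \<longlongrightarrow> 0) (at p within U)"
    by (intro Lim_cong_within) auto
  then show ?thesis
    unfolding has_vector_derivative_def has_derivative_within tendsto_norm_zero_iff
    by (simp add: bounded_linear_scaleR_left Lim_null[symmetric])
qed

text \<open>Dominated convergence for the difference quotients along an arbitrary sequence in
  \<open>U\<close> tending to \<open>p\<close>. Convexity of \<open>U\<close> gives the mean value
  inequality, which bounds each quotient by \<open>g\<close>.\<close>

lemma has_vector_derivative_integral_dominated: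
  fixes f :: "real \<Rightarrow> 'a \<Rightarrow> 'b::{banach, second_countable_topology}"
  assumes U: "open U" "convex U" "p \<in> U"
    and int: "\<And>q. q \<in> U \<Longrightarrow> integrable M (f q)"
    and der: "\<And>q l. q \<in> U \<Longrightarrow> ((\<lambda>q. f q l) has_vector_derivative f' q l) (at q)"
    and meas: "f' p \<in> borel_measurable M"
    and bound: "\<And>q l. q \<in> U \<Longrightarrow> norm (f' q l) \<le> g l"
    and g: "integrable M g"
  shows "((\<lambda>q. integral\<^sup>L M (f q)) has_vector_derivative integral\<^sup>L M (f' p)) (at p)"
proof -
  have "((\<lambda>q. (integral\<^sup>L M (f q) - integral\<^sup>L M (f p)) /\<^sub>R (q - p)) \<longlongrightarrow> integral\<^sup>L M (f' p)) (at p within U)"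
    unfolding tendsto_at_iff_sequentially
  proof (intro allI impI)
    fix X :: "nat \<Rightarrow> real" assume X: "\<forall>i. X i \<in> U - {p}" and lim: "X \<longlonglongrightarrow> p"
    have "(\<lambda>i. \<integral>l. (f (X i) l - f p l) /\<^sub>R (X i - p) \<partial>M) \<longlonglongrightarrow> integral\<^sup>L M (f' p)"
    proof (rule integral_dominated_convergence[where w = g])
      show "(\<lambda>l. (f (X i) l - f p l) /\<^sub>R (X i - p)) \<in> borel_measurable M" for i
        using int X U by (intro borel_measurable_scaleR borel_measurable_diff borel_measurable_const
            borel_measurable_integrable) auto
      show "AE l in M. (\<lambda>i. (f (X i) l - f p l) /\<^sub>R (X i - p)) \<longlonglongrightarrow> f' p l"
      proof (rule AE_I2)
        fix l
        have "((\<lambda>q. (f q l - f p l) /\<^sub>R (q - p)) \<longlongrightarrow> f' p l) (at p)"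
          using der[OF U(3), of l] by (simp add: has_vector_derivative_iff_tendsto)
        then show "(\<lambda>i. (f (X i) l - f p l) /\<^sub>R (X i - p)) \<longlonglongrightarrow> f' p l"
          using X lim unfolding tendsto_at_iff_sequentially by (auto simp: o_def)
      qed
      show "AE l in M. norm ((f (X i) l - f p l) /\<^sub>R (X i - p)) \<le> g l" for i
      proof (rule AE_I2)
        fix l
        have "norm (f (X i) l - f p l) \<le> g l * \<bar>X i - p\<bar>"
          using X U bound
          by (intro vector_derivative_bound[where f' = "\<lambda>q. f' q l" and S = U])
            (auto intro: has_vector_derivative_at_within der)
        moreover have "\<bar>X i - p\<bar> > 0" using X by auto
        ultimately show "norm ((f (X i) l - f p l) /\<^sub>R (X i - p)) \<le> g l"
          unfolding norm_scaleR by (simp add: field_simps)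
      qed
    qed (fact meas g)+
    note lim_eq = this
    have eq: "(\<integral>l. (f (X i) l - f p l) /\<^sub>R (X i - p) \<partial>M) =
        (integral\<^sup>L M (f (X i)) - integral\<^sup>L M (f p)) /\<^sub>R (X i - p)" for i
      unfolding integral_scaleR_right using X int U(3) by (subst Bochner_Integration.integral_diff) auto
    show "((\<lambda>q. (integral\<^sup>L M (f q) - integral\<^sup>L M (f p)) /\<^sub>R (q - p)) \<circ> X) \<longlonglongrightarrow> integral\<^sup>L M (f' p)"
      using lim_eq unfolding o_def eq .
  qed
  then show ?thesis
    unfolding has_vector_derivative_iff_tendsto at_within_open[OF U(3,1)] .
qed

text \<open>The majorant for all frequency integrals: the factor \<open>1 + \<bar>l\<bar>\<close>
  absorbs symbols of linear growth.\<close>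

lemma integrable_exp_abs:
  fixes c :: real
  assumes "c > 0"
  shows "integrable lborel (\<lambda>l. (1 + \<bar>l\<bar>) * exp (- c * \<bar>l\<bar>))"
proof -
  let ?f = "\<lambda>l::real. (1 + \<bar>l\<bar>) * exp (- c * \<bar>l\<bar>)"
  let ?F = "\<lambda>l::real. - ((1 + l) / c + 1 / c\<^sup>2) * exp (- c * l)"
  have "set_integrable lborel (einterval 0 \<infinity>) ?f"
  proof (rule interval_integral_FTC_nonneg)
    show "DERIV ?F l :> ?f l" if "0 < ereal l" for l
      using that assms by (auto intro!: derivative_eq_intros simp: field_simps power2_eq_square)
    show "((?F \<circ> real_of_ereal) \<longlongrightarrow> - (1 / c + 1 / c\<^sup>2)) (at_right 0)"
      unfolding zero_ereal_def ereal_tendsto_simps using assms by (auto intro!: tendsto_eq_intros)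
    show "((?F \<circ> real_of_ereal) \<longlongrightarrow> 0) (at_left \<infinity>)"
      unfolding ereal_tendsto_simps using assms by real_asymp
  qed (use assms in \<open>auto intro!: continuous_intros\<close>)
  then have "has_bochner_integral lborel (\<lambda>x. indicator {0<..} x *\<^sub>R ?f x) (LBINT x:{0<..}. ?f x)"
    unfolding set_integrable_def set_lebesgue_integral_def
    by (intro has_bochner_integral_integrable) (auto simp: einterval_def zero_ereal_def greaterThan_def)
  \<comment> \<open>The null point 0 is added because the rule for even functions starts from the
    closed half line.\<close>
  then have "has_bochner_integral lborel (\<lambda>x. indicator {0..} x *\<^sub>R ?f x) (LBINT x:{0<..}. ?f x)"
    by (rule has_bochner_integral_discrete_difference[where X="{0}", THEN iffD1, rotated 4])
      (auto split: split_indicator)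
  from has_bochner_integral_even_function[OF this] show ?thesis
    by (auto simp: has_bochner_integral_iff)
qed

section \<open>Superpositions of plane waves\<close>

text \<open>The Laplacian in \<open>(x, y)\<close> multiplies this wave by
  \<open>(\<sigma> l)\<^sup>2 - l\<^sup>2\<close>. So it solves the modified Helmholtz equation for
  \<open>decay_rate \<beta>\<close> and the Laplace equation for \<open>abs\<close>.\<close>

definition plane_wave :: "(real \<Rightarrow> real) \<Rightarrow> real \<Rightarrow> real \<Rightarrow> real \<Rightarrow> complex" where
  "plane_wave \<sigma> x y l = of_real (exp (- \<sigma> l * x)) * exp (\<i> * of_real (l * y))"

definition wave_integral :: "(real \<Rightarrow> real) \<Rightarrow> (real \<Rightarrow> complex) \<Rightarrow> real \<Rightarrow> real \<Rightarrow> complex" where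
  "wave_integral \<sigma> \<mu> x y = (LINT l|lborel. \<mu> l * plane_wave \<sigma> x y l)"

lemma norm_plane_wave [simp]: "norm (plane_wave \<sigma> x y l) = exp (- \<sigma> l * x)"
  unfolding plane_wave_def norm_mult by (simp only: norm_exp_i_times norm_of_real) simp

lemma plane_wave_exp: "plane_wave \<sigma> x y l = exp (- of_real (\<sigma> l) * of_real x + \<i> * of_real l * of_real y)"
  unfolding plane_wave_def exp_add exp_of_real[symmetric] by (simp add: mult.assoc)

lemma plane_wave_add: "plane_wave \<sigma> (x + x') (y + y') l = plane_wave \<sigma> x y l * plane_wave \<sigma> x' y' l"
  unfolding plane_wave_exp exp_add[symmetric] by (simp add: algebra_simps)

lemma has_vector_derivative_plane_wave_x:
  "((\<lambda>x. plane_wave \<sigma> x y l) has_vector_derivative - of_real (\<sigma> l) * plane_wave \<sigma> x y l) (at x)"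
  unfolding plane_wave_exp
  by (rule has_vector_derivative_real_field) (auto intro!: derivative_eq_intros)

lemma has_vector_derivative_plane_wave_y:
  "((\<lambda>y. plane_wave \<sigma> x y l) has_vector_derivative \<i> * of_real l * plane_wave \<sigma> x y l) (at y)"
  unfolding plane_wave_exp
  by (rule has_vector_derivative_real_field) (auto intro!: derivative_eq_intros)

text \<open>Common frame for \<open>decay_rate \<beta>\<close> (with \<open>b = \<beta>\<close>) and
  \<open>abs\<close> (with \<open>b = 0\<close>). The lower bound gives exponential decay of the
  waves, the upper bound linear growth of the factor that a derivative in \<open>x\<close>
  produces.\<close>

locale dispersion =
  fixes \<sigma> :: "real \<Rightarrow> real" and b :: real
  assumes measurable_sigma [measurable]: "\<sigma> \<in> borel_measurable borel"
    and sigma_lower: "\<And>l. \<bar>l\<bar> \<le> \<sigma> l"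
    and sigma_upper: "\<And>l. \<sigma> l \<le> \<bar>l\<bar> + b"
begin

lemma b_nonneg: "b \<ge> 0"
  using sigma_lower[of 0] sigma_upper[of 0] by simp

lemma sigma_le: "\<sigma> l \<le> (1 + b) * (1 + \<bar>l\<bar>)"
  using sigma_upper[of l] b_nonneg by (auto simp: algebra_simps intro: order_trans)

lemma plane_wave_bound:
  assumes "c \<le> x" "0 \<le> c"
  shows "exp (- \<sigma> l * x) \<le> exp (- c * \<bar>l\<bar>)"
proof -
  have "c * \<bar>l\<bar> \<le> \<sigma> l * x"
    using mult_mono[OF sigma_lower[of l] assms(1)] assms sigma_lower[of l] by (simp add: mult.commute)
  then show ?thesis by simp
qed

lemma measurable_plane_wave [measurable]: "plane_wave \<sigma> x y \<in> borel_measurable borel"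
  unfolding plane_wave_def by measurable

text \<open>The exponent uses a lower bound \<open>c\<close> of \<open>x\<close> instead of
  \<open>x\<close> itself, so one majorant serves a whole range of \<open>x\<close>.\<close>

lemma norm_wave_le:
  assumes "norm (m :: complex) \<le> C * (1 + \<bar>l\<bar>)" "c \<le> x" "0 \<le> c"
  shows "norm (m * plane_wave \<sigma> x y l) \<le> C * ((1 + \<bar>l\<bar>) * exp (- c * \<bar>l\<bar>))"
  using mult_mono[OF assms(1) plane_wave_bound[OF assms(2,3), of l]] order_trans[OF norm_ge_zero assms(1)]
  by (simp add: norm_mult mult.assoc)

lemma integrable_wave:
  assumes [measurable]: "\<mu> \<in> borel_measurable borel"
    and bound: "\<And>l. norm (\<mu> l) \<le> C * (1 + \<bar>l\<bar>)" and "x > 0"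
  shows "integrable lborel (\<lambda>l. \<mu> l * plane_wave \<sigma> x y l)"
proof (rule Bochner_Integration.integrable_bound)
  show "integrable lborel (\<lambda>l. C * ((1 + \<bar>l\<bar>) * exp (- x * \<bar>l\<bar>)))"
    using integrable_exp_abs[OF \<open>x > 0\<close>] by simp
  show "AE l in lborel. norm (\<mu> l * plane_wave \<sigma> x y l) \<le> norm (C * ((1 + \<bar>l\<bar>) * exp (- x * \<bar>l\<bar>)))"
  proof (rule AE_I2)
    show "norm (\<mu> l * plane_wave \<sigma> x y l) \<le> norm (C * ((1 + \<bar>l\<bar>) * exp (- x * \<bar>l\<bar>)))" for l
      using norm_wave_le[OF bound, of x x l y] assms(3) by (simp only: real_norm_def) linarith
  qed
qed simp

text \<open>A bounded symbol times \<open>\<sigma>\<close> grows at most linearly, which the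
  exponential absorbs. On the neighbourhood \<open>{x / 2<..}\<close> of \<open>x\<close> the decay
  rate stays at least \<open>x / 2\<close>, so the majorant is uniform.\<close>

lemma has_vector_derivative_wave_integral_x:
  assumes [measurable]: "\<mu> \<in> borel_measurable borel"
    and bound: "\<And>l. norm (\<mu> l) \<le> C" and "x > 0"
  shows "((\<lambda>x. wave_integral \<sigma> \<mu> x y) has_vector_derivative
      wave_integral \<sigma> (\<lambda>l. - of_real (\<sigma> l) * \<mu> l) x y) (at x)"
  unfolding wave_integral_def
proof (rule has_vector_derivative_integral_dominated)
  have "C \<ge> 0" using order_trans[OF norm_ge_zero bound] .
  then have C: "norm (\<mu> l) \<le> C * (1 + \<bar>l\<bar>)" for l
    using bound[of l] by (auto simp: algebra_simps intro: order_trans)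
  show "integrable lborel (\<lambda>l. \<mu> l * plane_wave \<sigma> q y l)" if "q \<in> {x / 2<..}" for q
    using that \<open>x > 0\<close> by (intro integrable_wave[OF _ C]) auto
  show "((\<lambda>q. \<mu> l * plane_wave \<sigma> q y l) has_vector_derivative
      - of_real (\<sigma> l) * \<mu> l * plane_wave \<sigma> q y l) (at q)" for q l
    by (rule has_vector_derivative_eq_rhs, rule derivative_intros,
        rule has_vector_derivative_plane_wave_x) simp
  have "norm (- of_real (\<sigma> l) * \<mu> l) \<le> (C * (1 + b)) * (1 + \<bar>l\<bar>)" for l
    using mult_mono[OF bound[of l] sigma_le[of l]] \<open>C \<ge> 0\<close> sigma_lower[of l]
    by (simp add: norm_mult mult_ac)
  then show "norm (- of_real (\<sigma> l) * \<mu> l * plane_wave \<sigma> q y l)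
      \<le> (C * (1 + b)) * ((1 + \<bar>l\<bar>) * exp (- (x / 2) * \<bar>l\<bar>))" if "q \<in> {x / 2<..}" for q l
    using that \<open>x > 0\<close> by (intro norm_wave_le) auto
  show "integrable lborel (\<lambda>l. (C * (1 + b)) * ((1 + \<bar>l\<bar>) * exp (- (x / 2) * \<bar>l\<bar>)))"
    using integrable_exp_abs[of "x / 2"] \<open>x > 0\<close> by simp
qed (use \<open>x > 0\<close> in auto)

lemma has_vector_derivative_wave_integral_y:
  assumes [measurable]: "\<mu> \<in> borel_measurable borel"
    and bound: "\<And>l. norm (\<mu> l) \<le> C" and "x > 0"
  shows "((\<lambda>y. wave_integral \<sigma> \<mu> x y) has_vector_derivative
      wave_integral \<sigma> (\<lambda>l. \<i> * of_real l * \<mu> l) x y) (at y)"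
  unfolding wave_integral_def
\<comment> \<open>The modulus of a plane wave does not depend on \<open>y\<close>, so the majorant
  holds on the whole line.\<close>
proof (rule has_vector_derivative_integral_dominated[where U = UNIV])
  have "C \<ge> 0" using order_trans[OF norm_ge_zero bound] .
  then have C: "norm (\<mu> l) \<le> C * (1 + \<bar>l\<bar>)" for l
    using bound[of l] by (auto simp: algebra_simps intro: order_trans)
  show "integrable lborel (\<lambda>l. \<mu> l * plane_wave \<sigma> x q l)" for q
    using \<open>x > 0\<close> by (intro integrable_wave[OF _ C]) auto
  show "((\<lambda>q. \<mu> l * plane_wave \<sigma> x q l) has_vector_derivative
      \<i> * of_real l * \<mu> l * plane_wave \<sigma> x q l) (at q)" for q l
    by (rule has_vector_derivative_eq_rhs, rule derivative_intros,
        rule has_vector_derivative_plane_wave_y) simp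
  have "norm (\<i> * of_real l * \<mu> l) \<le> C * (1 + \<bar>l\<bar>)" for l
    using mult_mono[OF bound[of l], of "\<bar>l\<bar>" "1 + \<bar>l\<bar>"] \<open>C \<ge> 0\<close>
    by (simp add: norm_mult mult_ac)
  then show "norm (\<i> * of_real l * \<mu> l * plane_wave \<sigma> x q l)
      \<le> C * ((1 + \<bar>l\<bar>) * exp (- x * \<bar>l\<bar>))" for q l
    using \<open>x > 0\<close> by (intro norm_wave_le) auto
  show "integrable lborel (\<lambda>l. C * ((1 + \<bar>l\<bar>) * exp (- x * \<bar>l\<bar>)))"
    using integrable_exp_abs[of x] \<open>x > 0\<close> by simp
qed auto

end

section \<open>The two dispersion relations\<close>

lemma dispersion_decay_rate:
  assumes "\<beta> > 0"
  shows "dispersion (decay_rate \<beta>) \<beta>"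
proof
  show "decay_rate \<beta> \<in> borel_measurable borel" unfolding decay_rate_def by measurable
  show "\<bar>l\<bar> \<le> decay_rate \<beta> l" for l by (simp add: decay_rate_def real_le_rsqrt)
  show "decay_rate \<beta> l \<le> \<bar>l\<bar> + \<beta>" for l
    using assms by (auto simp: decay_rate_def real_le_lsqrt power2_sum intro!: real_le_lsqrt)
qed

lemma dispersion_abs: "dispersion abs 0"
  by standard auto

section \<open>The Bessel and logarithmic potentials\<close>

lemma interval_integral_UNIV: "(LBINT l=-\<infinity>..\<infinity>. f l) = (LINT l|lborel. f l)"
  for f :: "real \<Rightarrow> 'a::{banach, second_countable_topology}"
  by (simp add: interval_lebesgue_integral_def set_lebesgue_integral_def)

text \<open>The Laplace transform of \<open>l\<close> at \<open>z\<close>. Integration by parts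
  gives the antiderivative \<open>?F\<close>, which equals \<open>- (1 / z\<^sup>2)\<close> at 0 and
  vanishes at infinity since \<open>Re z > 0\<close>.\<close>

lemma has_bochner_integral_half_line:
  fixes z :: complex
  assumes "Re z > 0"
  shows "has_bochner_integral lborel
    (\<lambda>l. indicator {0..} l *\<^sub>R (of_real l * exp (- z * of_real l))) (1 / z\<^sup>2)"
proof -
  let ?f = "\<lambda>l::real. of_real l * exp (- z * of_real l)"
  let ?F = "\<lambda>l::real. - (of_real l / z + 1 / z\<^sup>2) * exp (- z * of_real l)"
  have z: "z \<noteq> 0" "norm z > 0" using assms by auto
  have norm_exp: "norm (exp (- z * of_real l)) = exp (- Re z * l)" for l :: real
    by simp
  have int: "integrable lborel (\<lambda>l. indicator {0..} l *\<^sub>R ?f l)"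
  proof (rule Bochner_Integration.integrable_bound[OF integrable_exp_abs[OF assms]])
    show "AE l in lborel. norm (indicator {0..} l *\<^sub>R ?f l) \<le> norm ((1 + \<bar>l\<bar>) * exp (- Re z * \<bar>l\<bar>))"
      by (intro AE_I2) (auto simp: norm_mult mult_right_mono split: split_indicator)
  qed measurable
  have "(LBINT l=0..\<infinity>. ?f l) = 0 - (- (1 / z\<^sup>2))"
  proof (rule interval_integral_FTC_integrable)
    show "(?F has_vector_derivative ?f l) (at l)" for l
      using z by (intro has_vector_derivative_real_field)
        (auto intro!: derivative_eq_intros simp: field_simps power2_eq_square)
    have "set_integrable lborel {0..} ?f" using int by (simp add: set_integrable_def)
    then show "set_integrable lborel (einterval 0 \<infinity>) ?f"
      by (rule set_integrable_subset) (auto simp: zero_ereal_def)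
    show "((?F \<circ> real_of_ereal) \<longlongrightarrow> - (1 / z\<^sup>2)) (at_right 0)"
      unfolding zero_ereal_def ereal_tendsto_simps using z by (auto intro!: tendsto_eq_intros)
    have "norm (?F l) \<le> (\<bar>l\<bar> / norm z + 1 / (norm z)\<^sup>2) * exp (- Re z * l)" for l
      unfolding norm_mult norm_exp norm_minus_cancel
      by (intro mult_right_mono) (auto intro!: order_trans[OF norm_triangle_ineq] simp: norm_divide norm_power)
    moreover have "((\<lambda>l. (\<bar>l\<bar> / norm z + 1 / (norm z)\<^sup>2) * exp (- Re z * l)) \<longlongrightarrow> 0) at_top"
      using assms z by real_asymp
    ultimately show "((?F \<circ> real_of_ereal) \<longlongrightarrow> 0) (at_left \<infinity>)"
      unfolding ereal_tendsto_simps by (rule Lim_null_comparison[OF always_eventually[OF allI]])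
  qed (auto intro!: continuous_intros)
  then have "(LBINT l:{0<..}. ?f l) = 1 / z\<^sup>2"
    by (simp add: interval_lebesgue_integral_def zero_ereal_def)
  then have "(LBINT l:{0..}. ?f l) = 1 / z\<^sup>2"
    using set_integral_discrete_difference[of "{0}" "{0<..}" "{0..}" lborel ?f] by fastforce
  then show ?thesis
    using int by (simp add: has_bochner_integral_iff set_lebesgue_integral_def)
qed

text \<open>The wave is \<open>exp (- z * l)\<close> for \<open>l \<ge> 0\<close> and
  \<open>exp (cnj z * l)\<close> for \<open>l \<le> 0\<close>, so each half line contributes one
  Laplace transform.\<close>

lemma wave_integral_abs:
  fixes x y :: real
  assumes "x > 0"
  defines "z \<equiv> Complex x (- y)"
  shows "wave_integral abs (\<lambda>l. of_real \<bar>l\<bar>) x y = 1 / z\<^sup>2 + 1 / (cnj z)\<^sup>2"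
    and "wave_integral abs of_real x y = 1 / z\<^sup>2 - 1 / (cnj z)\<^sup>2"
proof -
  let ?f = "\<lambda>z l. indicator {0..} l *\<^sub>R (of_real l * exp (- z * of_real l)) :: complex"
  have "Re z > 0" "Re (cnj z) > 0" using assms by auto
  note pos = has_bochner_integral_half_line[OF this(1)]
  have neg: "has_bochner_integral lborel (\<lambda>l. ?f (cnj z) (- l)) (1 / (cnj z)\<^sup>2)"
    using has_bochner_integral_half_line[OF \<open>Re (cnj z) > 0\<close>]
      lborel_has_bochner_integral_real_affine_iff[of "-1" "?f (cnj z)" "1 / (cnj z)\<^sup>2" 0] by simp
  have wave: "plane_wave abs x y l = exp (- (if l \<ge> 0 then z else - cnj z) * of_real l)" for l
    unfolding plane_wave_exp
    by (rule arg_cong[where f = exp]) (auto simp: z_def complex_eq_iff)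
  have "of_real \<bar>l\<bar> * plane_wave abs x y l = ?f z l + ?f (cnj z) (- l)"
    and "of_real l * plane_wave abs x y l = ?f z l - ?f (cnj z) (- l)" for l
    unfolding wave by (cases l "0 :: real" rule: linorder_cases; simp)+
  then show "wave_integral abs (\<lambda>l. of_real \<bar>l\<bar>) x y = 1 / z\<^sup>2 + 1 / (cnj z)\<^sup>2"
    and "wave_integral abs of_real x y = 1 / z\<^sup>2 - 1 / (cnj z)\<^sup>2"
    using has_bochner_integral_add[OF pos neg] has_bochner_integral_diff[OF pos neg]
    unfolding wave_integral_def by (auto simp: has_bochner_integral_iff)
qed

text \<open>With \<open>r\<close> the distance from the origin, the first value is twice the second
  \<open>y\<close> derivative of \<open>ln r\<close>, the second is minus twice its mixed
  derivative. Comparing at this level avoids the symbol \<open>1 / \<bar>l\<bar>\<close> of the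
  logarithm itself, whose integral diverges at 0.\<close>

lemma wave_integral_abs_Re_Im:
  assumes "x > 0"
  shows "Re (wave_integral abs (\<lambda>l. of_real \<bar>l\<bar>) x y) = 2 * (x\<^sup>2 - y\<^sup>2) / (x\<^sup>2 + y\<^sup>2)\<^sup>2"
    and "Im (wave_integral abs of_real x y) = 4 * x * y / (x\<^sup>2 + y\<^sup>2)\<^sup>2"
proof -
  have sq: "(Complex x (- y))\<^sup>2 = Complex (x\<^sup>2 - y\<^sup>2) (- (2 * x * y))"
    "(cnj (Complex x (- y)))\<^sup>2 = Complex (x\<^sup>2 - y\<^sup>2) (2 * x * y)"
    by (simp_all add: complex_eq_iff power2_eq_square)
  have "(x\<^sup>2 - y\<^sup>2)\<^sup>2 + (2 * x * y)\<^sup>2 = (x\<^sup>2 + y\<^sup>2)\<^sup>2"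
    by (simp add: power2_eq_square algebra_simps)
  then show "Re (wave_integral abs (\<lambda>l. of_real \<bar>l\<bar>) x y) = 2 * (x\<^sup>2 - y\<^sup>2) / (x\<^sup>2 + y\<^sup>2)\<^sup>2"
    and "Im (wave_integral abs of_real x y) = 4 * x * y / (x\<^sup>2 + y\<^sup>2)\<^sup>2"
    unfolding wave_integral_abs[OF assms] sq by (simp_all add: Re_divide Im_divide)
qed

text \<open>Conjugating a plane wave reflects \<open>y\<close>; this later gives the parity of the
  Stokeslet.\<close>

lemma wave_integral_cnj:
  "wave_integral \<sigma> (\<lambda>l. cnj (\<mu> l)) x (- y) = cnj (wave_integral \<sigma> \<mu> x y)"
  unfolding wave_integral_def Bochner_Integration.integral_cnj[symmetric]
  by (rule Bochner_Integration.integral_cong) (simp_all add: plane_wave_def exp_cnj)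

lemma wave_integral_cmult: "wave_integral \<sigma> (\<lambda>l. c * \<mu> l) x y = c * wave_integral \<sigma> \<mu> x y"
  by (simp add: wave_integral_def mult.assoc)

text \<open>The factor \<open>- \<i>\<close> makes this coincide, for
  \<open>\<sigma>' = l / \<sigma>\<close>, with the derivative of
  \<open>plane_wave / \<sigma>\<close> in the polar angle of \<open>(x, y)\<close>.\<close>

lemma has_vector_derivative_plane_wave_frequency:
  assumes "(\<sigma> has_real_derivative \<sigma>') (at l)"
  shows "((\<lambda>l. - \<i> * plane_wave \<sigma> x y l) has_vector_derivative
    (of_real y + \<i> * of_real x * of_real \<sigma>') * plane_wave \<sigma> x y l) (at l)"
proof -
  have phase: "((\<lambda>l. - of_real (\<sigma> l) * of_real x + \<i> * of_real l * of_real y) has_vector_derivative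
      - of_real \<sigma>' * of_real x + \<i> * of_real y) (at l)"
    by (rule has_vector_derivative_eq_rhs,
        (rule derivative_intros has_vector_derivative_of_real assms)+) simp
  note chain = field_vector_diff_chain_at[OF phase DERIV_exp, unfolded o_def, folded plane_wave_exp]
  have "- \<i> * ((- of_real \<sigma>' * of_real x + \<i> * of_real y) * plane_wave \<sigma> x y l) =
      (of_real y + \<i> * of_real x * of_real \<sigma>') * plane_wave \<sigma> x y l"
    using i_squared by algebra
  with has_vector_derivative_mult_right[OF chain, of "- \<i>"] show ?thesis
    by simp
qed

lemma sqrt_sum_squares_scale:
  fixes a c :: real
  assumes "c > 0"
  shows "c * sqrt (1 + (a / c)\<^sup>2) = sqrt (c\<^sup>2 + a\<^sup>2)"
proof -
  have "c\<^sup>2 + a\<^sup>2 = c\<^sup>2 * (1 + (a / c)\<^sup>2)"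
    using assms by (simp add: field_simps power_divide)
  then show ?thesis using assms by (simp only: real_sqrt_mult real_sqrt_abs)
qed

lemma decay_rate_pos: "\<beta> > 0 \<Longrightarrow> decay_rate \<beta> l > 0"
  by (simp add: decay_rate_def add_nonneg_pos)

lemma decay_rate_ge: "\<beta> > 0 \<Longrightarrow> decay_rate \<beta> l \<ge> \<beta>"
  by (simp add: decay_rate_def real_le_rsqrt)

lemma has_real_derivative_decay_rate:
  assumes "\<beta> > 0"
  shows "(decay_rate \<beta> has_real_derivative l / decay_rate \<beta> l) (at l)"
proof -
  have "l\<^sup>2 + \<beta>\<^sup>2 > 0" using assms by (simp add: add_nonneg_pos)
  then show ?thesis
    unfolding decay_rate_def[abs_def] by (auto intro!: derivative_eq_intros simp: field_simps)
qed

lemma isCont_decay_rate [continuous_intros]: "isCont (decay_rate \<beta>) l"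
  unfolding decay_rate_def by (intro continuous_intros)

section \<open>The Bessel potential: independence of the angle and value on the axis\<close>

context
  fixes \<beta> :: real
  assumes beta_pos: "\<beta> > 0"
begin

interpretation dispersion "decay_rate \<beta>" \<beta>
  by (rule dispersion_decay_rate[OF beta_pos])

lemma decay_rate_nonzero: "decay_rate \<beta> l \<noteq> 0"
  using decay_rate_pos[OF beta_pos, of l] by simp

lemma norm_frequency_ratio_le: "norm (\<i> * of_real l * (1 / of_real (decay_rate \<beta> l)) :: complex) \<le> 1"
  using sigma_lower[of l] decay_rate_pos[OF beta_pos, of l] by (simp add: norm_mult norm_divide)

lemma norm_inverse_decay_rate_le: "norm (1 / of_real (decay_rate \<beta> l) :: complex) \<le> 1 / \<beta>"
  using decay_rate_ge[OF beta_pos, of l] decay_rate_pos[OF beta_pos, of l] beta_pos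
  by (simp add: norm_divide field_simps)

text \<open>The integrand is the derivative with respect to the frequency of \<open>- \<i>\<close> times the plane wave.\<close>

lemma integral_total_derivative:
  assumes "x > 0"
  shows "(LINT l|lborel. (of_real y + \<i> * of_real x * of_real l / of_real (decay_rate \<beta> l)) *
    plane_wave (decay_rate \<beta>) x y l) = 0"
proof -
  let ?p = "plane_wave (decay_rate \<beta>) x y"
  let ?f = "\<lambda>l. (of_real y + \<i> * of_real x * of_real l / of_real (decay_rate \<beta> l)) * ?p l"
  have "norm (of_real y + \<i> * of_real x * of_real l / of_real (decay_rate \<beta> l)) \<le> (\<bar>y\<bar> + x) * (1 + \<bar>l\<bar>)" for l
  proof -
    let ?k = "\<i> * of_real l * (1 / of_real (decay_rate \<beta> l)) :: complex"
    have "norm (of_real y + of_real x * ?k) \<le> \<bar>y\<bar> + x * norm ?k"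
      using norm_triangle_ineq[of "of_real y" "of_real x * ?k"] assms
      by (simp only: norm_mult[of "of_real x"] norm_of_real)
    also have "\<dots> \<le> \<bar>y\<bar> + x * 1"
      using assms norm_frequency_ratio_le[of l] by (intro add_left_mono mult_left_mono) auto
    also have "\<dots> \<le> (\<bar>y\<bar> + x) * (1 + \<bar>l\<bar>)"
      using assms by (simp add: algebra_simps)
    finally show ?thesis by (simp add: mult_ac)
  qed
  then have int: "integrable lborel ?f"
    using assms by (intro integrable_wave) auto
  have "(LBINT l=-\<infinity>..\<infinity>. ?f l) = 0 - 0"
  proof (rule interval_integral_FTC_integrable)
    show "((\<lambda>l. - \<i> * ?p l) has_vector_derivative ?f l) (at l)" for l
      using has_vector_derivative_plane_wave_frequency[OF has_real_derivative_decay_rate[OF beta_pos], of x y l]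
      by (simp only: of_real_divide times_divide_eq_right)
    show "isCont ?f l" for l
      unfolding plane_wave_exp using decay_rate_nonzero by (intro continuous_intros) auto
    show "set_integrable lborel (einterval (-\<infinity>) \<infinity>) ?f"
      using int by (simp add: set_integrable_def)
    \<comment> \<open>This bound makes both boundary terms vanish.\<close>
    have bound: "norm (- \<i> * ?p l) \<le> exp (- x * \<bar>l\<bar>)" for l
      using plane_wave_bound[of x x l] assms by (simp add: norm_mult)
    have exp_lim: "((\<lambda>l. exp (- x * l)) \<longlongrightarrow> 0) at_top"
      using assms by real_asymp
    have "((\<lambda>l. exp (- x * \<bar>l\<bar>)) \<longlongrightarrow> 0) at_top" "((\<lambda>l. exp (- x * \<bar>l\<bar>)) \<longlongrightarrow> 0) at_bot"
      by (rule filterlim_compose[OF exp_lim], real_asymp)+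
    from this[THEN Lim_null_comparison[OF always_eventually[OF allI[OF bound]]]]
    show "(((\<lambda>l. - \<i> * ?p l) \<circ> real_of_ereal) \<longlongrightarrow> 0) (at_left \<infinity>)"
        "(((\<lambda>l. - \<i> * ?p l) \<circ> real_of_ereal) \<longlongrightarrow> 0) (at_right (-\<infinity>))"
      unfolding ereal_tendsto_simps by this+
  qed simp
  then show ?thesis
    unfolding interval_integral_UNIV by (simp only: diff_self)
qed

text \<open>The derivative with respect to the polar angle is the integral of a total derivative in \<open>l\<close>, hence zero.\<close>

lemma wave_integral_rotate:
  assumes "r > 0" and "\<theta> \<in> {-pi/2<..<pi/2}"
  shows "wave_integral (decay_rate \<beta>) (\<lambda>l. 1 / of_real (decay_rate \<beta> l)) (r * cos \<theta>) (r * sin \<theta>) =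
    wave_integral (decay_rate \<beta>) (\<lambda>l. 1 / of_real (decay_rate \<beta> l)) r 0"
proof -
  define W where "W \<theta> = wave_integral (decay_rate \<beta>) (\<lambda>l. 1 / of_real (decay_rate \<beta> l)) (r * cos \<theta>) (r * sin \<theta>)" for \<theta>
  have W_deriv: "(W has_vector_derivative 0) (at \<theta>)" if \<theta>: "\<theta> \<in> {-pi/2<..<pi/2}" for \<theta>
  proof -
    let ?f = "\<lambda>\<theta> l. 1 / of_real (decay_rate \<beta> l) * plane_wave (decay_rate \<beta>) (r * cos \<theta>) (r * sin \<theta>) l"
    let ?f' = "\<lambda>\<theta> l. (of_real (r * sin \<theta>) + \<i> * of_real (r * cos \<theta>) * of_real l / of_real (decay_rate \<beta> l)) *
      plane_wave (decay_rate \<beta>) (r * cos \<theta>) (r * sin \<theta>) l"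
    \<comment> \<open>Midway between \<open>\<bar>\<theta>\<bar>\<close> and \<open>pi / 2\<close>:
      on \<open>{-\<theta>1<..<\<theta>1}\<close> the abscissa \<open>r * cos q\<close> is at least
      \<open>c > 0\<close>, which gives a uniform majorant.\<close>
    define \<theta>1 where "\<theta>1 = (\<bar>\<theta>\<bar> + pi / 2) / 2"
    define c where "c = r * cos \<theta>1"
    have \<theta>1: "\<bar>\<theta>\<bar> < \<theta>1" "\<theta>1 < pi / 2" "0 < \<theta>1" using \<theta> by (auto simp: \<theta>1_def)
    have "c > 0" using \<theta>1 \<open>r > 0\<close> by (auto simp: c_def cos_gt_zero)
    have cos_ge: "c \<le> r * cos q" if "q \<in> {-\<theta>1<..<\<theta>1}" for q
    proof -
      have "cos \<theta>1 \<le> cos \<bar>q\<bar>" using that \<theta>1 by (intro cos_monotone_0_pi_le) auto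
      then show ?thesis using \<open>r > 0\<close> by (simp add: c_def)
    qed
    have "((\<lambda>\<theta>. integral\<^sup>L lborel (?f \<theta>)) has_vector_derivative integral\<^sup>L lborel (?f' \<theta>)) (at \<theta>)"
    proof (rule has_vector_derivative_integral_dominated)
      show "integrable lborel (?f q)" if "q \<in> {-\<theta>1<..<\<theta>1}" for q
      proof (rule integrable_wave[where C = "1 / \<beta>"])
        show "norm (1 / of_real (decay_rate \<beta> l) :: complex) \<le> 1 / \<beta> * (1 + \<bar>l\<bar>)" for l
          using norm_inverse_decay_rate_le[of l] beta_pos by (auto simp: field_simps intro: order_trans)
        show "0 < r * cos q" using cos_ge[OF that] \<open>c > 0\<close> by simp
      qed measurable
      show "((\<lambda>q. ?f q l) has_vector_derivative ?f' q l) (at q)" for q l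
      proof -
        \<comment> \<open>The angle is extended to a complex variable, so that the rules for field
          derivatives apply; the result is then restricted to real angles.\<close>
        let ?g = "\<lambda>q :: complex. 1 / of_real (decay_rate \<beta> l) *
            exp (- of_real (decay_rate \<beta> l) * (of_real r * cos q) + \<i> * of_real l * (of_real r * sin q))"
        have "((\<lambda>q. ?g (of_real q)) has_vector_derivative ?f' q l) (at q)"
          unfolding plane_wave_exp using decay_rate_nonzero[of l]
          by (intro has_vector_derivative_real_field)
            (auto intro!: derivative_eq_intros simp: field_simps cos_of_real sin_of_real)
        then show ?thesis by (simp add: plane_wave_exp cos_of_real sin_of_real)
      qed
      show "norm (?f' q l) \<le> (2 * r) * ((1 + \<bar>l\<bar>) * exp (- c * \<bar>l\<bar>))" if "q \<in> {-\<theta>1<..<\<theta>1}" for q l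
      proof (rule norm_wave_le[OF _ cos_ge[OF that]])
        let ?k = "\<i> * of_real l * (1 / of_real (decay_rate \<beta> l)) :: complex"
        have "norm (of_real (r * sin q) + of_real (r * cos q) * ?k) \<le> \<bar>r * sin q\<bar> + \<bar>r * cos q\<bar> * norm ?k"
          using norm_triangle_ineq[of "of_real (r * sin q)" "of_real (r * cos q) * ?k"]
          by (simp only: norm_mult[of "of_real _"] norm_of_real)
        also have "\<dots> \<le> r * 1 + (r * 1) * 1"
          using \<open>r > 0\<close> norm_frequency_ratio_le[of l] abs_sin_le_one[of q] abs_cos_le_one[of q]
          by (intro add_mono mult_mono) (auto simp: abs_mult)
        also have "\<dots> \<le> 2 * r * (1 + \<bar>l\<bar>)" using \<open>r > 0\<close> by simp
        finally show "norm (of_real (r * sin q) + \<i> * of_real (r * cos q) * of_real l / of_real (decay_rate \<beta> l))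
            \<le> 2 * r * (1 + \<bar>l\<bar>)" by (simp add: mult_ac)
      qed (use \<open>c > 0\<close> in auto)
      show "integrable lborel (\<lambda>l. (2 * r) * ((1 + \<bar>l\<bar>) * exp (- c * \<bar>l\<bar>)))"
        using integrable_exp_abs[OF \<open>c > 0\<close>] by simp
    qed (use \<theta>1 in auto)
    moreover have "integral\<^sup>L lborel (?f' \<theta>) = 0"
    proof (rule integral_total_derivative)
      have "\<theta> \<in> {-\<theta>1<..<\<theta>1}" using \<theta>1 by auto
      then show "0 < r * cos \<theta>" using cos_ge[of \<theta>] \<open>c > 0\<close> by linarith
    qed
    ultimately show ?thesis by (simp add: W_def[abs_def] wave_integral_def)
  qed
  have "W constant_on {-pi/2<..<pi/2}"
  proof (rule has_vector_derivative_zero_constant)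
    show "convex {-pi/2<..<pi/2}" by simp
    show "(W has_vector_derivative 0) (at \<theta> within {-pi/2<..<pi/2})" if "\<theta> \<in> {-pi/2<..<pi/2}" for \<theta>
      using W_deriv[OF that] by (rule has_vector_derivative_at_within)
    show "W constant_on {-pi/2<..<pi/2}" if "\<And>\<theta>. \<theta> \<in> {-pi/2<..<pi/2} \<Longrightarrow> W \<theta> = k" for k
      unfolding constant_on_def using that by blast
  qed
  then have "W \<theta> = W 0" using assms(2) unfolding constant_on_def by auto
  then show ?thesis by (simp add: W_def)
qed

text \<open>Substitute \<open>l = \<beta> * sinh u\<close>: then
  \<open>decay_rate \<beta> l = \<beta> * cosh u\<close> and
  \<open>dl / decay_rate \<beta> l = du\<close>. The integrand becomes the even function whose
  half-line integral defines \<open>bessel_K 0\<close>, hence the factor 2.\<close>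

lemma wave_integral_axis:
  assumes "r > 0"
  shows "wave_integral (decay_rate \<beta>) (\<lambda>l. 1 / of_real (decay_rate \<beta> l)) r 0 = of_real (2 * bessel_K 0 (\<beta> * r))"
proof -
  let ?K = "\<lambda>u. exp (- (\<beta> * r) * cosh u)"
  let ?g = "\<lambda>l. arsinh (l / \<beta>)"
  have g: "?K (?g l) * (1 / decay_rate \<beta> l) = exp (- decay_rate \<beta> l * r) / decay_rate \<beta> l" for l
  proof -
    have "\<beta> * cosh (?g l) = decay_rate \<beta> l"
      using sqrt_sum_squares_scale[OF beta_pos, of l]
      by (simp add: cosh_arsinh_real decay_rate_def add.commute)
    then show ?thesis by (simp add: mult_ac)
  qed
  have int: "integrable lborel (\<lambda>l. 1 / of_real (decay_rate \<beta> l) * plane_wave (decay_rate \<beta>) r 0 l)"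
  proof (rule integrable_wave[where C = "1 / \<beta>"])
    show "norm (1 / of_real (decay_rate \<beta> l) :: complex) \<le> 1 / \<beta> * (1 + \<bar>l\<bar>)" for l
      using norm_inverse_decay_rate_le[of l] beta_pos by (auto simp: field_simps intro: order_trans)
  qed (use assms in measurable)
  have eq: "1 / of_real (decay_rate \<beta> l) * plane_wave (decay_rate \<beta>) r 0 l =
      complex_of_real (exp (- decay_rate \<beta> l * r) / decay_rate \<beta> l)" for l
    by (simp add: plane_wave_def)
  have int': "integrable lborel (\<lambda>l. exp (- decay_rate \<beta> l * r) / decay_rate \<beta> l)"
    using int unfolding eq by (simp only: complex_of_real_integrable_eq)
  have deriv: "DERIV ?g l :> 1 / decay_rate \<beta> l" for l
  proof -
    have scale: "\<beta> * sqrt ((l / \<beta>)\<^sup>2 + 1) = decay_rate \<beta> l"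
      using sqrt_sum_squares_scale[OF beta_pos, of l]
      by (simp add: decay_rate_def add.commute)
    have rate: "1 / sqrt ((l / \<beta>)\<^sup>2 + 1) * (1 / \<beta>) = 1 / decay_rate \<beta> l"
      unfolding scale[symmetric] by (simp add: mult.commute)
    have "((\<lambda>l. l / \<beta>) has_real_derivative 1 / \<beta>) (at l)"
      using beta_pos by (auto intro!: derivative_eq_intros)
    from DERIV_chain2[OF arsinh_real_has_field_derivative this] show ?thesis
      by (simp only: rate)
  qed
  have cont: "isCont (\<lambda>l. 1 / decay_rate \<beta> l) l" for l
    using decay_rate_nonzero by (intro continuous_intros) auto
  have lin: "filterlim (\<lambda>l. l / \<beta>) at_top at_top" "filterlim (\<lambda>l. l / \<beta>) at_bot at_bot"
    using beta_pos by real_asymp+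
  have top: "((ereal \<circ> ?g \<circ> real_of_ereal) \<longlongrightarrow> \<infinity>) (at_left \<infinity>)"
    unfolding ereal_tendsto_simps by (rule filterlim_compose[OF arsinh_real_at_top lin(1)])
  have bot: "((ereal \<circ> ?g \<circ> real_of_ereal) \<longlongrightarrow> -\<infinity>) (at_right (-\<infinity>))"
    unfolding ereal_tendsto_simps by (rule filterlim_compose[OF arsinh_real_at_bot lin(2)])
  have int'': "set_integrable lborel (einterval (-\<infinity>) \<infinity>) (\<lambda>l. ?K (?g l) * (1 / decay_rate \<beta> l))"
    unfolding g using int' by (simp add: set_integrable_def)
  have nonneg: "0 \<le> 1 / decay_rate \<beta> l" for l
    using decay_rate_pos[OF beta_pos, of l] by simp
  have contK: "isCont ?K u" for u
    by (intro continuous_intros)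
  \<comment> \<open>The substitution rule for nonnegative integrands yields integrability in
    \<open>u\<close> along with the value.\<close>
  have sub_K: "set_integrable lborel (einterval (-\<infinity>) \<infinity>) ?K"
    "(LBINT u=-\<infinity>..\<infinity>. ?K u) = (LBINT l=-\<infinity>..\<infinity>. ?K (?g l) * (1 / decay_rate \<beta> l))"
    using interval_integral_substitution_nonneg[of "-\<infinity>" \<infinity> ?g "\<lambda>l. 1 / decay_rate \<beta> l" ?K,
      OF _ deriv contK cont _ nonneg bot top int'']
    by simp_all
  have "integrable lborel (\<lambda>u. indicator {0..} u *\<^sub>R ?K u)"
    using set_integrable_subset[OF sub_K(1), of "{0..}"] by (simp add: set_integrable_def)
  then have "has_bochner_integral lborel (\<lambda>u. indicator {0..} u *\<^sub>R ?K u) (bessel_K 0 (\<beta> * r))"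
    by (simp add: has_bochner_integral_iff bessel_K_def set_lebesgue_integral_def)
  from has_bochner_integral_even_function[OF this]
  have "(LINT u|lborel. ?K u) = 2 * bessel_K 0 (\<beta> * r)"
    by (simp add: has_bochner_integral_iff)
  with sub_K(2) have "(LINT l|lborel. exp (- decay_rate \<beta> l * r) / decay_rate \<beta> l) = 2 * bessel_K 0 (\<beta> * r)"
    unfolding g interval_integral_UNIV by (simp only:)
  then show ?thesis
    unfolding wave_integral_def eq integral_complex_of_real by simp
qed

text \<open>Polar coordinates reduce to the axis; for \<open>x > 0\<close> the angle
  \<open>arctan (y / x)\<close> lies in the range of the rotation argument.\<close>

lemma wave_integral_bessel_K:
  assumes "x > 0"
  shows "wave_integral (decay_rate \<beta>) (\<lambda>l. 1 / of_real (decay_rate \<beta> l)) x y =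
    of_real (2 * bessel_K 0 (\<beta> * norm (x, y)))"
proof -
  have r: "norm (x, y) > 0" using assms by (simp add: zero_prod_def)
  define \<theta> where "\<theta> = arctan (y / x)"
  have "norm (x, y) = x * sqrt (1 + (y / x)\<^sup>2)"
    using sqrt_sum_squares_scale[OF assms, of y] by (simp add: norm_Pair)
  moreover have "sqrt (1 + (y / x)\<^sup>2) > 0"
    by (simp add: add_pos_nonneg)
  ultimately have "norm (x, y) * cos \<theta> = x" "norm (x, y) * sin \<theta> = y"
    using assms by (simp_all add: \<theta>_def cos_arctan sin_arctan)
  then show ?thesis
    using wave_integral_rotate[OF r, of \<theta>] wave_integral_axis[OF r] arctan_bounded[of "y / x"]
    by (simp add: \<theta>_def)
qed

end

section \<open>The modified Stokeslet\<close>

text \<open>The formula \<open>g\<close> will be valid only on a half line of abscissas, so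
  agreement is asked for on an open set. Moving in \<open>y\<close> stays inside the half plane,
  hence the simpler rule for \<open>partial_y\<close>.\<close>

lemma partial_x_eqI:
  assumes "open U" "x \<in> U" "\<And>u. u \<in> U \<Longrightarrow> f (u, y) = g u" "(g has_real_derivative D) (at x)"
  shows "partial_x f (x, y) = D"
proof -
  have "((\<lambda>u. f (u, y)) has_real_derivative D) (at x)"
    by (rule has_field_derivative_transform_within_open[OF assms(4,1,2)]) (simp add: assms(3))
  then show ?thesis by (simp add: partial_x_def DERIV_imp_deriv)
qed

lemma partial_y_eqI:
  assumes "\<And>v. f (x, v) = g v" "(g has_real_derivative D) (at y)"
  shows "partial_y f (x, y) = D"
  using assms by (simp add: partial_y_def DERIV_imp_deriv)

lemma has_real_derivative_log_potential:
  fixes x y :: real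
  assumes "x \<noteq> 0"
  shows "((\<lambda>x. ln (x\<^sup>2 + y\<^sup>2) / 2) has_real_derivative x / (x\<^sup>2 + y\<^sup>2)) (at x)"
    and "((\<lambda>y. ln (x\<^sup>2 + y\<^sup>2) / 2) has_real_derivative y / (x\<^sup>2 + y\<^sup>2)) (at y)"
    and "((\<lambda>x. x / (x\<^sup>2 + y\<^sup>2)) has_real_derivative (y\<^sup>2 - x\<^sup>2) / (x\<^sup>2 + y\<^sup>2)\<^sup>2) (at x)"
    and "((\<lambda>y. y / (x\<^sup>2 + y\<^sup>2)) has_real_derivative (x\<^sup>2 - y\<^sup>2) / (x\<^sup>2 + y\<^sup>2)\<^sup>2) (at y)"
    and "((\<lambda>x. y / (x\<^sup>2 + y\<^sup>2)) has_real_derivative - (2 * x * y) / (x\<^sup>2 + y\<^sup>2)\<^sup>2) (at x)"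
proof -
  have r: "x\<^sup>2 + y\<^sup>2 > 0" using assms by (simp add: add_pos_nonneg)
  show "((\<lambda>x. ln (x\<^sup>2 + y\<^sup>2) / 2) has_real_derivative x / (x\<^sup>2 + y\<^sup>2)) (at x)"
    "((\<lambda>y. ln (x\<^sup>2 + y\<^sup>2) / 2) has_real_derivative y / (x\<^sup>2 + y\<^sup>2)) (at y)"
    using r assms by (auto intro!: derivative_eq_intros simp: field_simps)
  show "((\<lambda>x. x / (x\<^sup>2 + y\<^sup>2)) has_real_derivative (y\<^sup>2 - x\<^sup>2) / (x\<^sup>2 + y\<^sup>2)\<^sup>2) (at x)"
    "((\<lambda>y. y / (x\<^sup>2 + y\<^sup>2)) has_real_derivative (x\<^sup>2 - y\<^sup>2) / (x\<^sup>2 + y\<^sup>2)\<^sup>2) (at y)"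
    "((\<lambda>x. y / (x\<^sup>2 + y\<^sup>2)) has_real_derivative - (2 * x * y) / (x\<^sup>2 + y\<^sup>2)\<^sup>2) (at x)"
    using r by (auto intro!: derivative_eq_intros simp: power2_eq_square)
qed

text \<open>Chain rule for the inner map \<open>s * x\<close>; with \<open>s = - 1\<close> it
  carries the representation to the left half plane.\<close>

lemma (in dispersion) has_real_derivative_Re_wave_integral_x:
  assumes "\<mu> \<in> borel_measurable borel" "\<And>l. norm (\<mu> l) \<le> C" "s * x > 0"
  shows "((\<lambda>x. Re (wave_integral \<sigma> \<mu> (s * x) y)) has_real_derivative
      s * Re (wave_integral \<sigma> (\<lambda>l. - of_real (\<sigma> l) * \<mu> l) (s * x) y)) (at x)"
proof -
  have "((\<lambda>x. s * x) has_vector_derivative s) (at x)"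
    using has_vector_derivative_mult_right[OF has_vector_derivative_id, where a = s] by simp
  from vector_diff_chain_at[OF this has_vector_derivative_wave_integral_x[OF assms, of y]]
  show ?thesis
    unfolding has_real_derivative_iff_has_vector_derivative o_def
    by (drule_tac bounded_linear.has_vector_derivative[OF bounded_linear_Re]) simp
qed

lemma (in dispersion) has_real_derivative_Re_wave_integral_y:
  assumes "\<mu> \<in> borel_measurable borel" "\<And>l. norm (\<mu> l) \<le> C" "x > 0"
  shows "((\<lambda>y. Re (wave_integral \<sigma> \<mu> x y)) has_real_derivative
      Re (wave_integral \<sigma> (\<lambda>l. \<i> * of_real l * \<mu> l) x y)) (at y)"
  unfolding has_real_derivative_iff_has_vector_derivative
  by (rule bounded_linear.has_vector_derivative[OF bounded_linear_Re
      has_vector_derivative_wave_integral_y[OF assms]])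

text \<open>The plane wave form of the entries of \<open>G_MS\<close> for \<open>x > 0\<close>: the
  \<open>M_beta\<close> integral is the Bessel part and the \<open>M_zero\<close> integral the
  logarithmic part.\<close>

definition green :: "real \<Rightarrow> 2 \<Rightarrow> 2 \<Rightarrow> real \<Rightarrow> real \<Rightarrow> real" where
  "green \<beta> i j x y = Re (wave_integral (decay_rate \<beta>) (\<lambda>l. M_beta \<beta> l $ i $ j) x y +
     wave_integral abs (\<lambda>l. M_zero l $ i $ j) x y) / (4 * pi * \<beta>\<^sup>2)"

text \<open>The sign \<open>s\<close> selects the half plane \<open>s * x > 0\<close>, on which the plane wave representation is used.\<close>

context
  fixes \<beta> s :: real
  assumes beta_pos: "\<beta> > 0" and s: "s * s = 1"
begin

interpretation dispersion "decay_rate \<beta>" \<beta>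
  by (rule dispersion_decay_rate[OF beta_pos])

private abbreviation "W \<equiv> wave_integral (decay_rate \<beta>)"
text \<open>Symbol of twice the Bessel potential, followed by the symbols of its first derivatives
  in \<open>s * x\<close> and in \<open>y\<close>.\<close>

private abbreviation "\<mu>0 \<equiv> \<lambda>l. 1 / complex_of_real (decay_rate \<beta> l)"
private abbreviation "\<mu>x \<equiv> \<lambda>l. - complex_of_real (decay_rate \<beta> l) * \<mu>0 l"
private abbreviation "\<mu>y \<equiv> \<lambda>l. \<i> * complex_of_real l * \<mu>0 l"
private abbreviation "c \<equiv> - (1 / (2 * pi * \<beta>\<^sup>2))"

section \<open>Derivatives of \<open>G_MB\<close> up to second order on a half plane\<close>

lemma half_plane: "open {u. s * u > 0}"
  by (intro open_Collect_less continuous_intros)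

text \<open>The potential depends on the norm only, so \<open>x\<close> may be replaced by
  \<open>s * x > 0\<close>.\<close>

lemma G_MB_wave:
  assumes "s * x > 0"
  shows "G_MB \<beta> (x, y) = c * (Re (W \<mu>0 (s * x) y) / 2 + ln (x\<^sup>2 + y\<^sup>2) / 2)"
proof -
  have "(s * x)\<^sup>2 = x\<^sup>2" using s by (simp add: power2_eq_square mult_ac)
  then have norm: "norm (s * x, y) = norm (x, y)" by (simp add: norm_Pair)
  have "x \<noteq> 0" using assms by auto
  then have "ln (1 / norm (x, y)) = - (ln (x\<^sup>2 + y\<^sup>2) / 2)"
    by (simp add: norm_Pair ln_div ln_sqrt add_pos_nonneg sum_power2_eq_zero_iff)
  then show ?thesis
    using wave_integral_bessel_K[OF beta_pos assms, of y] by (simp add: G_MB_def norm)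
qed

lemma norm_mu_x: "norm (\<mu>x l) \<le> 1"
  using decay_rate_nonzero[OF beta_pos, of l] by simp

lemma partial_y_G_MB:
  assumes "s * x > 0"
  shows "partial_y (G_MB \<beta>) (x, y) = c * (Re (W \<mu>y (s * x) y) / 2 + y / (x\<^sup>2 + y\<^sup>2))"
proof (rule partial_y_eqI)
  have "x \<noteq> 0" using assms by auto
  show "((\<lambda>y. c * (Re (W \<mu>0 (s * x) y) / 2 + ln (x\<^sup>2 + y\<^sup>2) / 2)) has_real_derivative
      c * (Re (W \<mu>y (s * x) y) / 2 + y / (x\<^sup>2 + y\<^sup>2))) (at y)"
    by (intro DERIV_cmult DERIV_add DERIV_cdivide has_real_derivative_log_potential \<open>x \<noteq> 0\<close>
        has_real_derivative_Re_wave_integral_y[OF _ norm_inverse_decay_rate_le[OF beta_pos] assms]) measurable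
qed (rule G_MB_wave[OF assms])

lemma partial_x_G_MB:
  assumes "s * x > 0"
  shows "partial_x (G_MB \<beta>) (x, y) = c * (s * Re (W \<mu>x (s * x) y) / 2 + x / (x\<^sup>2 + y\<^sup>2))"
proof (rule partial_x_eqI[OF half_plane])
  have "x \<noteq> 0" using assms by auto
  show "((\<lambda>x. c * (Re (W \<mu>0 (s * x) y) / 2 + ln (x\<^sup>2 + y\<^sup>2) / 2)) has_real_derivative
      c * (s * Re (W \<mu>x (s * x) y) / 2 + x / (x\<^sup>2 + y\<^sup>2))) (at x)"
    by (intro DERIV_cmult DERIV_add DERIV_cdivide has_real_derivative_log_potential \<open>x \<noteq> 0\<close>
        has_real_derivative_Re_wave_integral_x[OF _ norm_inverse_decay_rate_le[OF beta_pos] assms]) measurable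
qed (use assms in \<open>auto simp: G_MB_wave\<close>)

lemma partial_yy_G_MB:
  assumes "s * x > 0"
  shows "partial_y (partial_y (G_MB \<beta>)) (x, y) =
    c * (Re (W (\<lambda>l. \<i> * of_real l * \<mu>y l) (s * x) y) / 2 + (x\<^sup>2 - y\<^sup>2) / (x\<^sup>2 + y\<^sup>2)\<^sup>2)"
proof (rule partial_y_eqI)
  have "x \<noteq> 0" using assms by auto
  show "((\<lambda>y. c * (Re (W \<mu>y (s * x) y) / 2 + y / (x\<^sup>2 + y\<^sup>2))) has_real_derivative
      c * (Re (W (\<lambda>l. \<i> * of_real l * \<mu>y l) (s * x) y) / 2 + (x\<^sup>2 - y\<^sup>2) / (x\<^sup>2 + y\<^sup>2)\<^sup>2)) (at y)"
    by (intro DERIV_cmult DERIV_add DERIV_cdivide has_real_derivative_log_potential \<open>x \<noteq> 0\<close>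
        has_real_derivative_Re_wave_integral_y[OF _ norm_frequency_ratio_le[OF beta_pos] assms]) measurable
qed (rule partial_y_G_MB[OF assms])

lemma partial_xy_G_MB:
  assumes "s * x > 0"
  shows "partial_x (partial_y (G_MB \<beta>)) (x, y) =
    c * (s * Re (W (\<lambda>l. - of_real (decay_rate \<beta> l) * \<mu>y l) (s * x) y) / 2 + - (2 * x * y) / (x\<^sup>2 + y\<^sup>2)\<^sup>2)"
proof (rule partial_x_eqI[OF half_plane])
  have "x \<noteq> 0" using assms by auto
  show "((\<lambda>x. c * (Re (W \<mu>y (s * x) y) / 2 + y / (x\<^sup>2 + y\<^sup>2))) has_real_derivative
      c * (s * Re (W (\<lambda>l. - of_real (decay_rate \<beta> l) * \<mu>y l) (s * x) y) / 2 + - (2 * x * y) / (x\<^sup>2 + y\<^sup>2)\<^sup>2)) (at x)"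
    by (intro DERIV_cmult DERIV_add DERIV_cdivide has_real_derivative_log_potential \<open>x \<noteq> 0\<close>
        has_real_derivative_Re_wave_integral_x[OF _ norm_frequency_ratio_le[OF beta_pos] assms]) measurable
qed (use assms in \<open>auto simp: partial_y_G_MB\<close>)

lemma partial_xx_G_MB:
  assumes "s * x > 0"
  shows "partial_x (partial_x (G_MB \<beta>)) (x, y) =
    c * (s * (s * Re (W (\<lambda>l. - of_real (decay_rate \<beta> l) * \<mu>x l) (s * x) y)) / 2 + (y\<^sup>2 - x\<^sup>2) / (x\<^sup>2 + y\<^sup>2)\<^sup>2)"
proof (rule partial_x_eqI[OF half_plane])
  have "x \<noteq> 0" using assms by auto
  show "((\<lambda>x. c * (s * Re (W \<mu>x (s * x) y) / 2 + x / (x\<^sup>2 + y\<^sup>2))) has_real_derivative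
      c * (s * (s * Re (W (\<lambda>l. - of_real (decay_rate \<beta> l) * \<mu>x l) (s * x) y)) / 2 + (y\<^sup>2 - x\<^sup>2) / (x\<^sup>2 + y\<^sup>2)\<^sup>2)) (at x)"
    by (intro DERIV_cmult DERIV_add DERIV_cdivide has_real_derivative_log_potential \<open>x \<noteq> 0\<close>
        has_real_derivative_Re_wave_integral_x[OF _ norm_mu_x assms]) measurable
qed (use assms in \<open>auto simp: partial_x_G_MB\<close>)

text \<open>The minus sign of the mixed symbol, the negative prefactor \<open>c\<close> and the
  signs in \<open>G_MS\<close> combine so that every entry carries \<open>M_beta\<close> with a plus
  sign.\<close>

lemma symbols:
  shows "(\<lambda>l. \<i> * of_real l * \<mu>y l) = (\<lambda>l. M_beta \<beta> l $ 1 $ 1)"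
    and "(\<lambda>l. - of_real (decay_rate \<beta> l) * \<mu>y l) = (\<lambda>l. - 1 * M_beta \<beta> l $ 1 $ 2)"
    and "(\<lambda>l. - of_real (decay_rate \<beta> l) * \<mu>x l) = (\<lambda>l. M_beta \<beta> l $ 2 $ 2)"
  using decay_rate_nonzero[OF beta_pos]
  by (auto simp: M_beta_def fun_eq_iff power2_eq_square complex_eq_iff)

text \<open>Each derivative in \<open>x\<close> brings out one factor \<open>s\<close>. The diagonal
  entries contain none or \<open>s * s = 1\<close>, the mixed derivative exactly one.\<close>

lemma G_MS_wave:
  assumes "s * x > 0"
  shows "G_MS \<beta> (x, y) $ i $ j = (if i = j then 1 else s) * green \<beta> i j (s * x) y"
proof -
  have sq: "(s * x)\<^sup>2 = x\<^sup>2" using s by (simp add: power2_eq_square mult_ac)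
  have "wave_integral abs (\<lambda>l. M_zero l $ 1 $ 1) = wave_integral abs (\<lambda>l. of_real \<bar>l\<bar>)"
    by (simp add: M_zero_def)
  moreover have "wave_integral abs (\<lambda>l. M_zero l $ 1 $ 2) X Y = - \<i> * wave_integral abs of_real X Y"
    and "wave_integral abs (\<lambda>l. M_zero l $ 2 $ 2) X Y = - 1 * wave_integral abs (\<lambda>l. of_real \<bar>l\<bar>) X Y" for X Y
    unfolding wave_integral_cmult[symmetric] by (simp_all add: M_zero_def)
  ultimately have green:
    "green \<beta> 1 1 (s * x) y = (Re (W (\<lambda>l. M_beta \<beta> l $ 1 $ 1) (s * x) y) + 2 * ((x\<^sup>2 - y\<^sup>2) / (x\<^sup>2 + y\<^sup>2)\<^sup>2)) / (4 * pi * \<beta>\<^sup>2)"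
    "green \<beta> 1 2 (s * x) y = (Re (W (\<lambda>l. M_beta \<beta> l $ 1 $ 2) (s * x) y) + s * (2 * (2 * x * y / (x\<^sup>2 + y\<^sup>2)\<^sup>2))) / (4 * pi * \<beta>\<^sup>2)"
    "green \<beta> 2 2 (s * x) y = (Re (W (\<lambda>l. M_beta \<beta> l $ 2 $ 2) (s * x) y) + 2 * ((y\<^sup>2 - x\<^sup>2) / (x\<^sup>2 + y\<^sup>2)\<^sup>2)) / (4 * pi * \<beta>\<^sup>2)"
    using wave_integral_abs_Re_Im[OF assms, of y] by (simp_all add: green_def sq add_divide_distrib diff_divide_distrib)
  have sym: "green \<beta> 2 1 (s * x) y = green \<beta> 1 2 (s * x) y"
    by (simp add: green_def M_beta_def M_zero_def)
  have diagonal: "- (c * (A / 2 + B)) = (A + 2 * B) / (4 * pi * \<beta>\<^sup>2)" for A B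
    using beta_pos by (simp add: field_simps)
  have "G_MS \<beta> (x, y) $ 1 $ 1 = - partial_y (partial_y (G_MB \<beta>)) (x, y)"
    by (simp add: G_MS_def)
  then have "G_MS \<beta> (x, y) $ 1 $ 1 = green \<beta> 1 1 (s * x) y"
    unfolding green partial_yy_G_MB[OF assms] symbols diagonal .
  moreover have "G_MS \<beta> (x, y) $ 2 $ 2 = - partial_x (partial_x (G_MB \<beta>)) (x, y)"
    by (simp add: G_MS_def)
  then have "G_MS \<beta> (x, y) $ 2 $ 2 = green \<beta> 2 2 (s * x) y"
    unfolding green partial_xx_G_MB[OF assms] symbols mult.assoc[symmetric, of s s] s mult_1 diagonal .
  moreover have "partial_x (partial_y (G_MB \<beta>)) (x, y) = s * green \<beta> 1 2 (s * x) y"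
  proof -
    have "c * (s * (- A) / 2 + - B) = s * ((A + s * (2 * B)) / (4 * pi * \<beta>\<^sup>2))" for A B
    proof -
      have "s * ((A + s * (2 * B)) / (4 * pi * \<beta>\<^sup>2)) = (s * A + (s * s) * (2 * B)) / (4 * pi * \<beta>\<^sup>2)"
        by (simp add: algebra_simps)
      then show ?thesis unfolding s using beta_pos by (simp add: field_simps)
    qed
    then show ?thesis
      unfolding green partial_xy_G_MB[OF assms] symbols wave_integral_cmult by simp
  qed
  then have "G_MS \<beta> (x, y) $ 1 $ 2 = s * green \<beta> 1 2 (s * x) y"
    "G_MS \<beta> (x, y) $ 2 $ 1 = s * green \<beta> 2 1 (s * x) y"
    by (simp_all add: G_MS_def sym)
  ultimately show ?thesis
    using exhaust_2[of i] exhaust_2[of j] by auto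
qed

end

text \<open>Diagonal symbols are real and off-diagonal ones purely imaginary, so conjugation changes
  only the sign of the latter, and real parts ignore conjugation of the integral.\<close>

lemma green_minus_y: "green \<beta> i j x (- y) = (if i = j then 1 else - 1) * green \<beta> i j x y"
proof -
  let ?e = "(if i = j then 1 else - 1)"
  have "M_beta \<beta> l $ i $ j = ?e * cnj (M_beta \<beta> l $ i $ j)" "M_zero l $ i $ j = ?e * cnj (M_zero l $ i $ j)" for l
    using exhaust_2[of i] exhaust_2[of j] by (auto simp: M_beta_def M_zero_def)
  then have "wave_integral (decay_rate \<beta>) (\<lambda>l. M_beta \<beta> l $ i $ j) x (- y) =
      ?e * cnj (wave_integral (decay_rate \<beta>) (\<lambda>l. M_beta \<beta> l $ i $ j) x y)"
    "wave_integral abs (\<lambda>l. M_zero l $ i $ j) x (- y) = ?e * cnj (wave_integral abs (\<lambda>l. M_zero l $ i $ j) x y)"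
    unfolding wave_integral_cnj[symmetric] wave_integral_cmult[symmetric] by simp_all
  then show ?thesis by (simp add: green_def)
qed

text \<open>Point reflection swaps the half planes and reflects \<open>y\<close>; an off-diagonal
  entry changes sign under each, so twice in total.\<close>

lemma G_MS_minus:
  assumes "\<beta> > 0" "fst p \<noteq> 0"
  shows "G_MS \<beta> (- p) = G_MS \<beta> p"
proof -
  \<comment> \<open>This sign puts \<open>p\<close> in the half plane of \<open>s\<close> and
    \<open>- p\<close> in that of \<open>- s\<close>.\<close>
  define s where "s = sgn (fst p)"
  have s: "s * s = 1" "(- s) * (- s) = 1" "s * fst p > 0"
    using assms(2) by (auto simp: s_def sgn_if)
  have "G_MS \<beta> (- p) $ i $ j = G_MS \<beta> p $ i $ j" for i j
    using G_MS_wave[OF assms(1) s(1,3), of "snd p" i j] G_MS_wave[OF assms(1) s(2), of "- fst p" "- snd p" i j] s(3)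
    by (simp add: green_minus_y uminus_prod_def)
  then show ?thesis by (simp add: vec_eq_iff)
qed

section \<open>Sums over the far images\<close>

text \<open>For \<open>\<sigma> = abs\<close> the denominator vanishes at \<open>l = 0\<close>; the value there is 0.\<close>

definition geometric_symbol :: "(real \<Rightarrow> real) \<Rightarrow> real \<Rightarrow> (real \<Rightarrow> complex) \<Rightarrow> real \<Rightarrow> complex" where
  "geometric_symbol \<sigma> d \<mu> l = \<mu> l / of_real (1 - exp (- \<sigma> l * d))"

text \<open>Shifting \<open>x\<close> by \<open>d\<close> multiplies the wave by
  \<open>?q l\<close>, so the integrands form a geometric series with positive ratio. Their norms
  therefore sum to the norm of the limit \<open>?g\<close>, whose integrability justifies exchanging
  sum and integral. The bound of \<open>\<mu>\<close> by \<open>\<sigma>\<close> compensates the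
  zero of \<open>1 - ?q l\<close> where \<open>\<sigma>\<close> vanishes.\<close>

lemma (in dispersion) wave_integral_geometric_series:
  assumes [measurable]: "\<mu> \<in> borel_measurable borel"
    and bound: "\<And>l. norm (\<mu> l) \<le> \<sigma> l" and d: "d > 0" and x: "x > 0"
  defines "\<nu> \<equiv> geometric_symbol \<sigma> d \<mu>"
  shows "integrable lborel (\<lambda>l. \<nu> l * plane_wave \<sigma> x y l)"
    and "summable (\<lambda>m. norm (wave_integral \<sigma> \<mu> (x + real m * d) y))"
    and "(\<lambda>m. wave_integral \<sigma> \<mu> (x + real m * d) y) sums wave_integral \<sigma> \<nu> x y"
proof -
  let ?q = "\<lambda>l. exp (- \<sigma> l * d)"
  let ?f = "\<lambda>m l. \<mu> l * plane_wave \<sigma> (x + real m * d) y l"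
  let ?g = "\<lambda>l. \<nu> l * plane_wave \<sigma> x y l"
  have sigma_nonneg: "\<sigma> l \<ge> 0" for l
    using sigma_lower[of l] by linarith
  \<comment> \<open>Where \<open>\<mu>\<close> vanishes, all terms and the limit are 0, whatever the
    denominator; elsewhere the ratio is below 1.\<close>
  have q_less: "?q l < 1" if "\<mu> l \<noteq> 0" for l
  proof -
    have "\<sigma> l > 0" using bound[of l] that by (smt (verit) norm_le_zero_iff)
    then show ?thesis using d by simp
  qed
  have wave: "?f m l = \<mu> l * plane_wave \<sigma> x y l * of_real (?q l) ^ m" for m l
    using plane_wave_add[of \<sigma> x "real m * d" y 0 l]
    by (simp add: plane_wave_def exp_of_nat_mult[symmetric] mult_ac flip: of_real_power)
  have sums: "(\<lambda>m. ?f m l) sums ?g l" for l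
  proof (cases "\<mu> l = 0")
    case False
    then have "(\<lambda>m. of_real (?q l) ^ m) sums (1 / (1 - of_real (?q l)) :: complex)"
      using q_less[of l] by (intro geometric_sums) simp
    from sums_mult[OF this, of "\<mu> l * plane_wave \<sigma> x y l"] show ?thesis
      unfolding wave by (simp add: \<nu>_def geometric_symbol_def)
  qed (simp add: \<nu>_def geometric_symbol_def)
  have norm_wave: "norm (?f m l) = norm (\<mu> l * plane_wave \<sigma> x y l) * ?q l ^ m" for m l
    unfolding wave by (simp add: norm_mult norm_power)
  have norm_sums: "(\<lambda>m. norm (?f m l)) sums norm (?g l)" for l
  proof (cases "\<mu> l = 0")
    case False
    then have "(\<lambda>m. ?q l ^ m) sums (1 / (1 - ?q l))"
      using q_less[of l] by (intro geometric_sums) simp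
    moreover have "norm (?g l) = norm (\<mu> l * plane_wave \<sigma> x y l) * (1 / (1 - ?q l))"
      using q_less[OF False] by (simp only: \<nu>_def geometric_symbol_def norm_mult norm_divide norm_of_real) simp
    ultimately show ?thesis
      unfolding norm_wave by (simp only: sums_mult)
  qed (simp add: \<nu>_def geometric_symbol_def)
  have "norm (\<nu> l) \<le> (1 + b + 1 / d) * (1 + \<bar>l\<bar>)" for l
  proof (cases "\<mu> l = 0")
    case True
    then show ?thesis using b_nonneg d by (simp add: \<nu>_def geometric_symbol_def)
  next
    case False
    \<comment> \<open>With \<open>a = \<sigma> l * d\<close>, the inequality
      \<open>(1 + a) * exp (- a) \<le> 1\<close> gives
      \<open>a \<le> (1 + a) * (1 - exp (- a))\<close>. Dividing by \<open>d\<close> and the last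
      factor yields linear growth of \<open>\<nu>\<close>.\<close>
    have "1 \<le> (1 + \<sigma> l * d) * (1 - ?q l) + ?q l * (1 + \<sigma> l * d) - \<sigma> l * d"
      by (simp add: algebra_simps)
    moreover have "?q l * (1 + \<sigma> l * d) \<le> 1"
      using exp_ge_add_one_self[of "\<sigma> l * d"] by (simp add: exp_minus field_simps)
    ultimately have "\<sigma> l * d \<le> (1 + \<sigma> l * d) * (1 - ?q l)" by linarith
    then have "\<sigma> l / (1 - ?q l) \<le> \<sigma> l + 1 / d"
      using q_less[OF False] d by (simp add: field_simps)
    moreover have "norm (\<nu> l) \<le> \<sigma> l / (1 - ?q l)"
      using q_less[OF False] bound[of l]
      by (simp only: \<nu>_def geometric_symbol_def norm_divide norm_of_real) (simp add: divide_right_mono)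
    moreover have "\<sigma> l + 1 / d \<le> (1 + b + 1 / d) * (1 + \<bar>l\<bar>)"
      using sigma_le[of l] mult_left_mono[of 1 "1 + \<bar>l\<bar>" "1 / d"] d
      unfolding distrib_right[of "1 + b" "1 / d"] by simp
    ultimately show ?thesis by linarith
  qed
  moreover have "\<nu> \<in> borel_measurable borel" unfolding \<nu>_def geometric_symbol_def[abs_def] by measurable
  ultimately show int: "integrable lborel ?g"
    using x by (intro integrable_wave) auto
  have int_f: "integrable lborel (?f m)" for m
  proof (rule integrable_wave[where C = "1 + b"])
    show "norm (\<mu> l) \<le> (1 + b) * (1 + \<bar>l\<bar>)" for l
      using bound[of l] sigma_le[of l] by linarith
    show "0 < x + real m * d" using x d by (simp add: add_pos_nonneg)
  qed measurable
  have "summable (\<lambda>m. LINT l|lborel. norm (?f m l))"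
  proof (rule summableI_nonneg_bounded)
    show "(\<Sum>m<n. LINT l|lborel. norm (?f m l)) \<le> (LINT l|lborel. norm (?g l))" for n
    proof -
      have "(\<Sum>m<n. LINT l|lborel. norm (?f m l)) = (LINT l|lborel. (\<Sum>m<n. norm (?f m l)))"
        using int_f by (subst Bochner_Integration.integral_sum) auto
      also have "\<dots> \<le> (LINT l|lborel. norm (?g l))"
      proof (rule integral_mono)
        show "(\<Sum>m<n. norm (?f m l)) \<le> norm (?g l)" for l
          using sum_le_suminf[of "\<lambda>m. norm (?f m l)" "{..<n}"] norm_sums[of l]
          by (simp add: sums_iff)
      qed (use int_f int in auto)
      finally show ?thesis .
    qed
  qed simp
  then show "summable (\<lambda>m. norm (wave_integral \<sigma> \<mu> (x + real m * d) y))"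
    unfolding wave_integral_def
    by (rule summable_comparison_test'[where N = 0]) (simp add: integral_norm_bound)
  have "(\<lambda>m. integral\<^sup>L lborel (?f m)) sums (LINT l|lborel. (\<Sum>m. ?f m l))"
  proof (rule sums_integral)
    show "AE l in lborel. summable (\<lambda>m. norm (?f m l))"
      using norm_sums by (auto simp: sums_iff)
  qed fact+
  moreover have "(\<Sum>m. ?f m l) = ?g l" for l
    using sums[of l] by (simp add: sums_iff)
  ultimately show "(\<lambda>m. wave_integral \<sigma> \<mu> (x + real m * d) y) sums wave_integral \<sigma> \<nu> x y"
    by (simp add: wave_integral_def)
qed

lemma symbol_bounds:
  assumes "\<beta> > 0"
  shows "norm (M_beta \<beta> l $ i $ j) \<le> decay_rate \<beta> l" "norm (M_zero l $ i $ j) \<le> \<bar>l\<bar>"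
proof -
  have "\<bar>l\<bar> \<le> decay_rate \<beta> l" by (simp add: decay_rate_def real_le_rsqrt)
  moreover have "l\<^sup>2 / decay_rate \<beta> l \<le> decay_rate \<beta> l"
    using decay_rate_pos[OF assms, of l] by (simp add: field_simps flip: power2_eq_square) (simp add: decay_rate_def)
  ultimately show "norm (M_beta \<beta> l $ i $ j) \<le> decay_rate \<beta> l" "norm (M_zero l $ i $ j) \<le> \<bar>l\<bar>"
    using exhaust_2[of i] exhaust_2[of j] decay_rate_pos[OF assms, of l]
    by (auto simp: M_beta_def M_zero_def norm_mult norm_divide norm_power)
qed

lemma measurable_symbols [measurable]:
  "(\<lambda>l. M_beta \<beta> l $ i $ j) \<in> borel_measurable borel"
  "(\<lambda>l. M_zero l $ i $ j) \<in> borel_measurable borel"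
  using exhaust_2[of i] exhaust_2[of j] by (auto simp: M_beta_def M_zero_def decay_rate_def)

text \<open>The contribution of one row of images, that is, \<open>green\<close> summed over the
  abscissas \<open>x + m * d\<close> with \<open>m \<ge> 0\<close>.\<close>

definition periodic_green :: "real \<Rightarrow> real \<Rightarrow> 2 \<Rightarrow> 2 \<Rightarrow> real \<Rightarrow> real \<Rightarrow> real" where
  "periodic_green d \<beta> i j x y =
    Re (wave_integral (decay_rate \<beta>) (geometric_symbol (decay_rate \<beta>) d (\<lambda>l. M_beta \<beta> l $ i $ j)) x y +
        wave_integral abs (geometric_symbol abs d (\<lambda>l. M_zero l $ i $ j)) x y) / (4 * pi * \<beta>\<^sup>2)"

lemma has_sum_finite_sum:
  fixes f :: "'a \<Rightarrow> 'b \<Rightarrow> 'c::topological_comm_monoid_add"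
  assumes "\<And>n. n \<in> N \<Longrightarrow> (f n has_sum S n) A"
  shows "((\<lambda>m. \<Sum>n\<in>N. f n m) has_sum (\<Sum>n\<in>N. S n)) A"
  using assms by (induction N rule: infinite_finite_induct) (auto intro: has_sum_add)

text \<open>Summability of the norms upgrades the ordered series to an unordered sum, as the
  infinite sums in \<open>K_far\<close> require.\<close>

lemma has_sum_green:
  assumes "\<beta> > 0" "d > 0" "x > 0"
  shows "((\<lambda>m::nat. green \<beta> i j (x + real m * d) y) has_sum periodic_green d \<beta> i j x y) UNIV"
proof (rule norm_summable_imp_has_sum)
  let ?W = "\<lambda>m::nat. wave_integral (decay_rate \<beta>) (\<lambda>l. M_beta \<beta> l $ i $ j) (x + real m * d) y"
  let ?Z = "\<lambda>m::nat. wave_integral abs (\<lambda>l. M_zero l $ i $ j) (x + real m * d) y"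
  note beta = dispersion.wave_integral_geometric_series[OF dispersion_decay_rate[OF assms(1)]
      measurable_symbols(1) symbol_bounds(1)[OF assms(1)] assms(2,3)]
  note zero = dispersion.wave_integral_geometric_series[OF dispersion_abs
      measurable_symbols(2) symbol_bounds(2)[OF assms(1)] assms(2,3)]
  have "(\<lambda>m. Re (?W m + ?Z m) / (4 * pi * \<beta>\<^sup>2)) sums periodic_green d \<beta> i j x y"
    unfolding periodic_green_def
    by (intro sums_divide sums_Re sums_add beta(3) zero(3))
  then show "(\<lambda>m. green \<beta> i j (x + real m * d) y) sums periodic_green d \<beta> i j x y"
    by (simp add: green_def)
  have "summable (\<lambda>m. (norm (?W m) + norm (?Z m)) / (4 * pi * \<beta>\<^sup>2))"
    by (intro summable_divide summable_add beta(2) zero(2))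
  then show "summable (\<lambda>m. norm (green \<beta> i j (x + real m * d) y))"
  proof (rule summable_comparison_test'[where N = 0])
    fix m :: nat
    have "\<bar>Re (?W m + ?Z m)\<bar> \<le> norm (?W m) + norm (?Z m)"
      by (rule order_trans[OF abs_Re_le_cmod norm_triangle_ineq])
    then show "norm (norm (green \<beta> i j (x + real m * d) y)) \<le> (norm (?W m) + norm (?Z m)) / (4 * pi * \<beta>\<^sup>2)"
      by (simp add: green_def abs_mult divide_right_mono)
  qed
qed

section \<open>Far images arranged in rows\<close>

text \<open>The singly periodic setting is treated as the single lattice row \<open>n = 0\<close>,
  so that both settings share all later arguments.\<close>

fun rows :: "setting \<Rightarrow> int set" where
  "rows Singly = {0}"
| "rows Doubly = {-1..1}"

fun near_width :: "setting \<Rightarrow> nat" where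
  "near_width Singly = 2"
| "near_width Doubly = 4"

lemma uminus_rows: "uminus ` rows k = rows k"
  by (cases k) auto

lemma far_indices_West: "far_indices k West = range (\<lambda>m. - int (near_width k + m))"
proof (cases k)
  case Singly
  have "x \<in> range (\<lambda>m. - int (2 + m))" if "x \<le> -2" for x
    using that by (intro image_eqI[of _ _ "nat (- x - 2)"]) auto
  then show ?thesis using Singly by auto
next
  case Doubly
  have "x \<in> range (\<lambda>m. - int (4 + m))" if "x \<le> -4" for x
    using that by (intro image_eqI[of _ _ "nat (- x - 4)"]) auto
  then show ?thesis using Doubly by auto
qed

lemma far_indices_East: "far_indices k East = uminus ` far_indices k West"
  by (cases k) (auto simp: image_iff intro!: bexI[of _ "- _"])

lemma K_far_rows:
  "K_far k a d \<xi> \<eta> \<beta> t s =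
    (\<Sum>\<^sub>\<infinity>m\<in>far_indices k a. \<Sum>n\<in>rows k. G_MS \<beta> (t - s - lattice_point d \<xi> \<eta> m n))"
  by (cases k) (simp_all add: lattice_point_def)

text \<open>\<open>(offset_x, offset_y)\<close> is \<open>t - s\<close> minus the lattice point of the nearest far image in row \<open>n\<close>
  to the west.\<close>

definition offset_x :: "setting \<Rightarrow> real \<Rightarrow> real \<Rightarrow> real \<times> real \<Rightarrow> real \<times> real \<Rightarrow> int \<Rightarrow> real" where
  "offset_x k d \<xi> t s n = fst t - fst s + real (near_width k) * d - of_int n * \<xi>"

definition offset_y :: "real \<Rightarrow> real \<times> real \<Rightarrow> real \<times> real \<Rightarrow> int \<Rightarrow> real" where
  "offset_y \<eta> t s n = snd t - snd s - of_int n * \<eta>"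

text \<open>In the singly periodic cell \<open>fst t - fst s \<ge> - d\<close>, against
  \<open>2 * d\<close>. In the doubly periodic one \<open>\<bar>\<xi>\<bar> \<le> d\<close> gives
  \<open>fst t - fst s \<ge> - 2 * d\<close> and a row shift of at most \<open>d\<close>, against
  \<open>4 * d\<close>.\<close>

lemma offset_x_pos:
  assumes "admissible k d \<xi> \<eta>" "t \<in> cell k d \<xi> \<eta>" "s \<in> cell k d \<xi> \<eta>" "n \<in> rows k"
  shows "offset_x k d \<xi> t s n > 0"
proof (cases k)
  case Singly
  then show ?thesis using assms by (auto simp: offset_x_def)
next
  case Doubly
  have d: "d > 0" and "\<eta> > 0" and sqrt: "sqrt (\<xi>\<^sup>2 + \<eta>\<^sup>2) \<le> d" using assms(1) Doubly by auto
  have "\<bar>\<xi>\<bar> \<le> sqrt (\<xi>\<^sup>2 + \<eta>\<^sup>2)" by (simp add: real_le_rsqrt)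
  then have xi: "\<bar>\<xi>\<bar> \<le> d" using sqrt by (rule order_trans)
  have half: "\<bar>u * v\<bar> \<le> d / 2" if "u \<in> {- 1/2 .. 1/2}" "\<bar>v\<bar> \<le> d" for u v
    using mult_mono[of "\<bar>u\<bar>" "1/2" "\<bar>v\<bar>" d] that by (auto simp: abs_mult)
  have fst: "\<bar>fst p\<bar> \<le> d" if p_in: "p \<in> cell Doubly d \<xi> \<eta>" for p
  proof -
    obtain u v where p: "p = u *\<^sub>R (d, 0) + v *\<^sub>R (\<xi>, \<eta>)" and uv: "u \<in> {- 1/2 .. 1/2}" "v \<in> {- 1/2 .. 1/2}"
      using p_in unfolding cell.simps by blast
    have "fst p = u * d + v * \<xi>" by (simp add: p)
    then show ?thesis using half[OF uv(1), of d] half[OF uv(2) xi] d by simp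
  qed
  have "\<bar>of_int n * \<xi>\<bar> \<le> d"
    using assms(4) Doubly xi mult_mono[of "\<bar>real_of_int n\<bar>" 1 "\<bar>\<xi>\<bar>" d] by (auto simp: abs_mult)
  then show ?thesis
    using fst[of t] fst[of s] assms(2,3) Doubly d by (simp add: offset_x_def)
qed

text \<open>With \<open>m\<close> replaced by \<open>- (near_width k + m)\<close>, every
  displacement is an offset moved right by \<open>m * d\<close>. All of them lie in the right half
  plane, where \<open>green\<close> represents the Stokeslet.\<close>

lemma K_far_West:
  assumes "\<beta> > 0" "admissible k d \<xi> \<eta>" "t \<in> cell k d \<xi> \<eta>" "s \<in> cell k d \<xi> \<eta>"
  shows "K_far k West d \<xi> \<eta> \<beta> t s $ i $ j =
    (\<Sum>n\<in>rows k. periodic_green d \<beta> i j (offset_x k d \<xi> t s n) (offset_y \<eta> t s n))"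
proof -
  let ?A = "\<lambda>m. \<Sum>n\<in>rows k. G_MS \<beta> (t - s - lattice_point d \<xi> \<eta> m n)"
  let ?S = "\<chi> i j. \<Sum>n\<in>rows k. periodic_green d \<beta> i j (offset_x k d \<xi> t s n) (offset_y \<eta> t s n)"
  have d: "d > 0" using assms(2) by (cases k) auto
  have point: "t - s - lattice_point d \<xi> \<eta> (- int (near_width k + m)) n =
      (offset_x k d \<xi> t s n + real m * d, offset_y \<eta> t s n)" for m n
    by (simp add: prod_eq_iff lattice_point_def offset_x_def offset_y_def algebra_simps)
  have entry: "?A (- int (near_width k + m)) $ i $ j =
      (\<Sum>n\<in>rows k. green \<beta> i j (offset_x k d \<xi> t s n + real m * d) (offset_y \<eta> t s n))" for m i j
    unfolding sum_component point
  proof (rule sum.cong)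
    fix n assume "n \<in> rows k"
    then have "offset_x k d \<xi> t s n + real m * d > 0"
      using offset_x_pos[OF assms(2-4)] d by (simp add: add_pos_nonneg)
    then show "G_MS \<beta> (offset_x k d \<xi> t s n + real m * d, offset_y \<eta> t s n) $ i $ j =
        green \<beta> i j (offset_x k d \<xi> t s n + real m * d) (offset_y \<eta> t s n)"
      using G_MS_wave[OF assms(1), of 1] by simp
  qed simp
  have "((\<lambda>m. ?A (- int (near_width k + m))) has_sum ?S) UNIV"
    \<comment> \<open>Convergence of the matrix sums is checked entry by entry.\<close>
    unfolding has_sum_def
  proof (intro vec_tendstoI)
    fix i j
    have "((\<lambda>m. ?A (- int (near_width k + m)) $ i $ j) has_sum ?S $ i $ j) UNIV"
      unfolding entry vec_lambda_beta
      by (intro has_sum_finite_sum has_sum_green assms d offset_x_pos[OF assms(2-4)])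
    then show "((\<lambda>M. sum (\<lambda>m. ?A (- int (near_width k + m))) M $ i $ j) \<longlongrightarrow> ?S $ i $ j) (finite_subsets_at_top UNIV)"
      by (simp only: has_sum_def sum_component)
  qed
  then have "(?A has_sum ?S) (far_indices k West)"
    unfolding far_indices_West by (subst has_sum_reindex) (auto simp: inj_on_def o_def)
  then have "K_far k West d \<xi> \<eta> \<beta> t s = ?S"
    unfolding K_far_rows by (rule infsumI)
  then show ?thesis by simp
qed

text \<open>Negating both lattice indices maps east to west and permutes the rows; the displacement
  becomes its negative with \<open>t\<close> and \<open>s\<close> exchanged, and the Stokeslet is
  even.\<close>

lemma K_far_East:
  assumes "\<beta> > 0" "admissible k d \<xi> \<eta>" "t \<in> cell k d \<xi> \<eta>" "s \<in> cell k d \<xi> \<eta>"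
  shows "K_far k East d \<xi> \<eta> \<beta> t s = K_far k West d \<xi> \<eta> \<beta> s t"
proof -
  have d: "d > 0" using assms(2) by (cases k) auto
  have "(\<Sum>n\<in>rows k. G_MS \<beta> (t - s - lattice_point d \<xi> \<eta> (- m) n)) =
      (\<Sum>n\<in>rows k. G_MS \<beta> (s - t - lattice_point d \<xi> \<eta> m n))"
    if m: "m \<in> far_indices k West" for m
  proof -
    have "(\<Sum>n\<in>rows k. G_MS \<beta> (t - s - lattice_point d \<xi> \<eta> (- m) n)) =
        (\<Sum>n\<in>rows k. G_MS \<beta> (t - s - lattice_point d \<xi> \<eta> (- m) (- n)))"
      using sum.reindex[of uminus "rows k" "\<lambda>n. G_MS \<beta> (t - s - lattice_point d \<xi> \<eta> (- m) n)"]
      by (simp add: uminus_rows o_def)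
    also have "\<dots> = (\<Sum>n\<in>rows k. G_MS \<beta> (s - t - lattice_point d \<xi> \<eta> m n))"
    proof (rule sum.cong)
      fix n assume n: "n \<in> rows k"
      obtain m' where m': "m = - int (near_width k + m')" using m by (auto simp: far_indices_West)
      have "fst (s - t - lattice_point d \<xi> \<eta> m n) = offset_x k d \<xi> s t n + real m' * d"
        by (simp add: m' lattice_point_def offset_x_def algebra_simps)
      also have "\<dots> > 0"
        using offset_x_pos[OF assms(2,4,3) n] d by (simp add: add_pos_nonneg)
      finally have "G_MS \<beta> (- (s - t - lattice_point d \<xi> \<eta> m n)) = G_MS \<beta> (s - t - lattice_point d \<xi> \<eta> m n)"
        by (intro G_MS_minus assms) simp
      moreover have "- (s - t - lattice_point d \<xi> \<eta> m n) = t - s - lattice_point d \<xi> \<eta> (- m) (- n)"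
        by (simp add: prod_eq_iff lattice_point_def)
      ultimately show "G_MS \<beta> (t - s - lattice_point d \<xi> \<eta> (- m) (- n)) = G_MS \<beta> (s - t - lattice_point d \<xi> \<eta> m n)"
        by metis
    qed simp
    finally show ?thesis .
  qed
  then show ?thesis
    unfolding K_far_rows far_indices_East by (subst infsum_reindex) (auto simp: o_def intro!: infsum_cong)
qed

section \<open>Integrals, block matrices and quadrature\<close>

text \<open>Every exponential in \<open>a_factor\<close> translates the wave: the power of
  \<open>exp (- \<sigma> l * d)\<close> by \<open>near_width k * d\<close> in \<open>x\<close>, and
  the three terms of \<open>B_factor\<close> by \<open>- n\<close> times
  \<open>(\<xi>, \<eta>)\<close> for \<open>n = - 1, 1, 0\<close>.\<close>

lemma a_factor_plane_wave:
  "a_factor k d \<xi> \<eta> (\<sigma> l) l * plane_wave \<sigma> u v l =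
    (\<Sum>n\<in>rows k. plane_wave \<sigma> (u + real (near_width k) * d - of_int n * \<xi>) (v - of_int n * \<eta>) l) /
      of_real (1 - exp (- \<sigma> l * d))"
proof (cases k)
  case Singly
  have "of_real (exp (- 2 * \<sigma> l * d)) * plane_wave \<sigma> u v l = plane_wave \<sigma> (u + 2 * d) v l"
    by (simp add: plane_wave_exp algebra_simps flip: exp_of_real exp_add)
  then show ?thesis using Singly by simp
next
  case Doubly
  have "of_real (exp (- 4 * \<sigma> l * d)) * B_factor \<xi> \<eta> (\<sigma> l) l * plane_wave \<sigma> u v l =
      plane_wave \<sigma> (u + 4 * d + \<xi>) (v + \<eta>) l + plane_wave \<sigma> (u + 4 * d) v l +
      plane_wave \<sigma> (u + 4 * d - \<xi>) (v - \<eta>) l"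
    unfolding B_factor_def plane_wave_exp exp_of_real[symmetric] distrib_left distrib_right exp_add[symmetric] mult_1_right
    by (simp add: algebra_simps)
  moreover have "rows k = {-1, 0, 1}" using Doubly by auto
  ultimately show ?thesis using Doubly by (simp add: add_ac)
qed

lemma F_beta_entry:
  "F_beta k d \<xi> \<eta> \<beta> l t s $ i $ j =
    (\<Sum>n\<in>rows k. geometric_symbol (decay_rate \<beta>) d (\<lambda>l. M_beta \<beta> l $ i $ j) l *
      plane_wave (decay_rate \<beta>) (offset_x k d \<xi> t s n) (offset_y \<eta> t s n) l) / of_real (4 * pi * \<beta>\<^sup>2)"
proof -
  have "F_beta k d \<xi> \<eta> \<beta> l t s $ i $ j = a_factor k d \<xi> \<eta> (decay_rate \<beta> l) l *
      plane_wave (decay_rate \<beta>) (fst t - fst s) (snd t - snd s) l * M_beta \<beta> l $ i $ j / of_real (4 * pi * \<beta>\<^sup>2)"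
    by (simp add: F_beta_def scale_matrix_def map_matrix_def plane_wave_def)
  then show ?thesis
    unfolding a_factor_plane_wave geometric_symbol_def sum_distrib_left[symmetric] offset_x_def offset_y_def
    by simp
qed

lemma F_zero_entry:
  "F_zero k d \<xi> \<eta> \<beta> l t s $ i $ j =
    (\<Sum>n\<in>rows k. geometric_symbol abs d (\<lambda>l. M_zero l $ i $ j) l *
      plane_wave abs (offset_x k d \<xi> t s n) (offset_y \<eta> t s n) l) / of_real (4 * pi * \<beta>\<^sup>2)"
proof -
  have "F_zero k d \<xi> \<eta> \<beta> l t s $ i $ j = a_factor k d \<xi> \<eta> \<bar>l\<bar> l *
      plane_wave abs (fst t - fst s) (snd t - snd s) l * M_zero l $ i $ j / of_real (4 * pi * \<beta>\<^sup>2)"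
    by (simp add: F_zero_def scale_matrix_def map_matrix_def plane_wave_def)
  then show ?thesis
    unfolding a_factor_plane_wave geometric_symbol_def sum_distrib_left[symmetric] offset_x_def offset_y_def
    by simp
qed

text \<open>Taking components commutes with the integral of an integrable function; integrability of
  the matrix function is assembled from its entries by means of \<open>axis\<close>.\<close>

lemma integral_matrix_component:
  fixes F :: "'a \<Rightarrow> complex^'n^'m"
  assumes "\<And>i j. integrable M (\<lambda>x. F x $ i $ j)"
  shows "integral\<^sup>L M F $ i $ j = (\<integral>x. F x $ i $ j \<partial>M)"
proof -
  have axis: "bounded_linear (\<lambda>z :: complex. axis i (axis j z) :: complex^'n^'m)" for i j
    unfolding linear_conv_bounded_linear[symmetric]
    by (rule linearI) (simp_all add: vec_eq_iff axis_def)
  have "F x = (\<Sum>i\<in>UNIV. \<Sum>j\<in>UNIV. axis i (axis j (F x $ i $ j)))" for x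
    unfolding vec_eq_iff sum_component
    by (subst sum.swap) (simp add: axis_def if_distrib[of "\<lambda>v. v $ _"] cong: if_cong)
  moreover have "integrable M (\<lambda>x. \<Sum>i\<in>UNIV. \<Sum>j\<in>UNIV. axis i (axis j (F x $ i $ j)))"
    by (intro Bochner_Integration.integrable_sum integrable_bounded_linear[OF axis] assms)
  ultimately have F: "integrable M F" by simp
  have "bounded_linear (\<lambda>A :: complex^'n^'m. A $ i $ j)"
    by (intro bounded_linear_compose[OF bounded_linear_vec_nth bounded_linear_vec_nth])
  from integral_bounded_linear[OF this F] show ?thesis by simp
qed

text \<open>An exact identity, so the quadratures are the only source of error.\<close>

lemma K_far_West_integrals:
  assumes "\<beta> > 0" "admissible k d \<xi> \<eta>" "t \<in> cell k d \<xi> \<eta>" "s \<in> cell k d \<xi> \<eta>"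
  shows "K_far k West d \<xi> \<eta> \<beta> t s $ i $ j =
    Re ((LINT l|lborel. F_beta k d \<xi> \<eta> \<beta> l t s) $ i $ j) +
    Re ((LINT l|lborel. F_zero k d \<xi> \<eta> \<beta> l t s) $ i $ j)"
proof -
  have d: "d > 0" using assms(2) by (cases k) auto
  let ?X = "offset_x k d \<xi> t s" and ?Y = "offset_y \<eta> t s"
  let ?b = "\<lambda>i j. geometric_symbol (decay_rate \<beta>) d (\<lambda>l. M_beta \<beta> l $ i $ j)"
  let ?z = "\<lambda>i j. geometric_symbol abs d (\<lambda>l. M_zero l $ i $ j)"
  note pos = offset_x_pos[OF assms(2-4)]
  note beta = dispersion.wave_integral_geometric_series(1)[OF dispersion_decay_rate[OF assms(1)]
      measurable_symbols(1) symbol_bounds(1)[OF assms(1)] d pos]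
  note zero = dispersion.wave_integral_geometric_series(1)[OF dispersion_abs
      measurable_symbols(2) symbol_bounds(2)[OF assms(1)] d pos]
  have "(LINT l|lborel. F_beta k d \<xi> \<eta> \<beta> l t s) $ i $ j =
      (\<Sum>n\<in>rows k. wave_integral (decay_rate \<beta>) (?b i j) (?X n) (?Y n)) / of_real (4 * pi * \<beta>\<^sup>2)"
    by (subst integral_matrix_component)
      (simp_all only: F_beta_entry integral_divide_zero wave_integral_def beta
        Bochner_Integration.integral_sum Bochner_Integration.integrable_sum Bochner_Integration.integrable_divide)
  moreover have "(LINT l|lborel. F_zero k d \<xi> \<eta> \<beta> l t s) $ i $ j =
      (\<Sum>n\<in>rows k. wave_integral abs (?z i j) (?X n) (?Y n)) / of_real (4 * pi * \<beta>\<^sup>2)"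
    by (subst integral_matrix_component)
      (simp_all only: F_zero_entry integral_divide_zero wave_integral_def zero
        Bochner_Integration.integral_sum Bochner_Integration.integrable_sum Bochner_Integration.integrable_divide)
  moreover have "K_far k West d \<xi> \<eta> \<beta> t s $ i $ j =
      Re ((\<Sum>n\<in>rows k. wave_integral (decay_rate \<beta>) (?b i j) (?X n) (?Y n)) / of_real (4 * pi * \<beta>\<^sup>2)) +
      Re ((\<Sum>n\<in>rows k. wave_integral abs (?z i j) (?X n) (?Y n)) / of_real (4 * pi * \<beta>\<^sup>2))"
    unfolding K_far_West[OF assms] periodic_green_def Re_divide_of_real
    by (simp only: sum_divide_distrib[symmetric] add_divide_distrib[symmetric] Re_sum plus_complex.sel sum.distrib)
  ultimately show ?thesis by simp
qed

section \<open>Algebra of block matrices\<close>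

lemma block_matrix_mult:
  "block_matrix A ** block_matrix B = block_matrix (\<lambda>l j. \<Sum>n\<in>UNIV. A l n ** B n j)"
  by (simp add: block_matrix_def matrix_matrix_mult_def vec_eq_iff sum.cartesian_product sum_component
      case_prod_beta flip: UNIV_Times_UNIV)

lemma block_matrix_add: "block_matrix A + block_matrix B = block_matrix (\<lambda>l j. A l j + B l j)"
  by (simp add: block_matrix_def vec_eq_iff)

lemma map_matrix_block_diagonal:
  "map_matrix cnj (block_diagonal A) = block_diagonal (\<lambda>n. map_matrix cnj (A n))"
  by (auto simp: block_matrix_def block_diagonal_def vec_eq_iff map_matrix_def)

lemma scale_matrix_mult: "scale_matrix a (mat 1) ** A = scale_matrix a A"
  "A ** scale_matrix a (mat 1) = scale_matrix a A"
  by (simp_all add: scale_matrix_def map_matrix_def matrix_matrix_mult_def mat_def vec_eq_iff forall_2 sum_2)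

lemma block_matrix_mult_diagonal:
  "block_matrix A ** block_diagonal D = block_matrix (\<lambda>l n. A l n ** D n)"
proof -
  have "(\<Sum>m\<in>UNIV. A l m ** (if m = n then D n else 0)) = A l n ** D n" for l n
    by (subst sum.remove[of _ n]) (auto intro!: sum.neutral simp: matrix_matrix_mult_def vec_eq_iff)
  then show ?thesis
    unfolding block_diagonal_def block_matrix_mult by simp
qed

text \<open>The outer blocks are scalar multiples of the identity, so they only scale the diagonal
  blocks.\<close>

lemma LDR_block:
  "block_matrix (\<lambda>l n. scale_matrix (a l n) (mat 1)) ** block_diagonal D **
     block_matrix (\<lambda>n j. scale_matrix (b n j) (mat 1)) =
   block_matrix (\<lambda>l j. \<Sum>n\<in>UNIV. scale_matrix (a l n * b n j) (D n))"
  unfolding block_matrix_mult_diagonal block_matrix_mult scale_matrix_mult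
  by (simp add: scale_matrix_def map_matrix_def o_def mult_ac)

section \<open>Recombining the separated phases into quadrature sums\<close>

lemma phase_mult:
  "of_real (exp (- \<sigma> * x)) * exp (\<i> * of_real (l * y)) * (of_real (exp (\<sigma> * x')) * exp (- \<i> * of_real (l * y'))) =
    of_real (exp (- \<sigma> * (x - x'))) * exp (\<i> * of_real (l * (y - y')))"
proof -
  have "exp (- \<sigma> * (x - x')) = exp (- \<sigma> * x) * exp (\<sigma> * x')"
    by (simp add: algebra_simps flip: exp_add)
  moreover have "exp (\<i> * of_real (l * (y - y'))) = exp (\<i> * of_real (l * y)) * exp (- \<i> * of_real (l * y'))"
    by (simp add: algebra_simps flip: exp_add)
  ultimately show ?thesis by simp
qed

text \<open>Reflecting \<open>x\<close> in both outer factors amounts to exchanging target and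
  source and conjugating. With the conjugated \<open>D\<close> blocks, the east matrix is thus the
  conjugate of the west quadrature sum with exchanged arguments.\<close>

lemma phase_mult_reflected:
  "of_real (exp (- \<sigma> * - x)) * exp (\<i> * of_real (l * y)) * (of_real (exp (\<sigma> * - x')) * exp (- \<i> * of_real (l * y'))) =
    cnj (of_real (exp (- \<sigma> * (x' - x))) * exp (\<i> * of_real (l * (y' - y))))"
proof -
  have "cnj (exp (\<i> * of_real (l * (y' - y)))) = exp (\<i> * of_real (l * (y - y')))"
    by (simp add: exp_cnj algebra_simps)
  then show ?thesis
    unfolding phase_mult by simp
qed

lemma P_matrix_West:
  "P_matrix k West d \<xi> \<eta> \<beta> w\<beta> node\<beta> w0 node0 t s = block_matrix (\<lambda>l j.
     (\<Sum>n\<in>UNIV. w\<beta> n *\<^sub>R F_beta k d \<xi> \<eta> \<beta> (node\<beta> n) (t l) (s j)) +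
     (\<Sum>n\<in>UNIV. w0 n *\<^sub>R F_zero k d \<xi> \<eta> \<beta> (node0 n) (t l) (s j)))"
  unfolding P_matrix.simps L_matrix_def R_matrix_def D_beta_def D_zero_def LDR_block block_matrix_add phase_mult
  by (simp add: F_beta_def F_zero_def scale_matrix_def map_matrix_def vec_eq_iff block_matrix_def)
    (simp add: scaleR_conv_of_real mult_ac)

lemma P_matrix_East:
  "P_matrix k East d \<xi> \<eta> \<beta> w\<beta> node\<beta> w0 node0 t s = block_matrix (\<lambda>l j. map_matrix cnj (
     (\<Sum>n\<in>UNIV. w\<beta> n *\<^sub>R F_beta k d \<xi> \<eta> \<beta> (node\<beta> n) (s j) (t l)) +
     (\<Sum>n\<in>UNIV. w0 n *\<^sub>R F_zero k d \<xi> \<eta> \<beta> (node0 n) (s j) (t l))))"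
  unfolding P_matrix.simps L_matrix_def R_matrix_def D_beta_def D_zero_def map_matrix_block_diagonal
    LDR_block block_matrix_add reflect_x_def o_def fst_conv snd_conv phase_mult_reflected
  by (simp add: F_beta_def F_zero_def scale_matrix_def map_matrix_def vec_eq_iff block_matrix_def)
    (simp add: scaleR_conv_of_real mult_ac)

section \<open>The error estimate\<close>

lemma block_matrix_vector_mult:
  "(block_matrix A *v block_vector q) $ (l, c) = (\<Sum>j\<in>UNIV. \<Sum>e\<in>UNIV. A l j $ c $ e * of_real (q j $ e))"
  by (simp add: block_matrix_def block_vector_def matrix_vector_mult_def sum.cartesian_product
      case_prod_beta flip: UNIV_Times_UNIV)

lemma quadrature_West:
  assumes "\<beta> > 0" "admissible k d \<xi> \<eta>"
    and "quadrature_of_precision \<epsilon> (cell k d \<xi> \<eta>) (F_beta k d \<xi> \<eta> \<beta>) w\<beta> node\<beta>"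
    and "quadrature_of_precision \<epsilon> (cell k d \<xi> \<eta>) (F_zero k d \<xi> \<eta> \<beta>) w0 node0"
    and "t \<in> cell k d \<xi> \<eta>" "s \<in> cell k d \<xi> \<eta>"
  shows "\<bar>Re (((\<Sum>n\<in>UNIV. w\<beta> n *\<^sub>R F_beta k d \<xi> \<eta> \<beta> (node\<beta> n) t s) +
      (\<Sum>n\<in>UNIV. w0 n *\<^sub>R F_zero k d \<xi> \<eta> \<beta> (node0 n) t s)) $ i $ j) -
      K_far k West d \<xi> \<eta> \<beta> t s $ i $ j\<bar> \<le> 2 * \<epsilon>"
proof -
  have "\<bar>Re ((LINT l|lborel. F_beta k d \<xi> \<eta> \<beta> l t s) $ i $ j) -
      Re ((\<Sum>n\<in>UNIV. w\<beta> n *\<^sub>R F_beta k d \<xi> \<eta> \<beta> (node\<beta> n) t s) $ i $ j)\<bar> \<le> \<epsilon>"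
    "\<bar>Re ((LINT l|lborel. F_zero k d \<xi> \<eta> \<beta> l t s) $ i $ j) -
      Re ((\<Sum>n\<in>UNIV. w0 n *\<^sub>R F_zero k d \<xi> \<eta> \<beta> (node0 n) t s) $ i $ j)\<bar> \<le> \<epsilon>"
    using assms(3-6) unfolding quadrature_of_precision_def by blast+
  then show ?thesis
    unfolding K_far_West_integrals[OF assms(1,2,5,6)] vector_add_component plus_complex.sel by linarith
qed

theorem theorem7:
  fixes k :: setting and a :: side
    and d \<xi> \<eta> \<beta> \<epsilon> :: real
    and w\<beta> node\<beta> :: "'n::finite \<Rightarrow> real"
    and w0 node0 :: "'m::finite \<Rightarrow> real"
    and s :: "'s::finite \<Rightarrow> real \<times> real"
    and t :: "'t::finite \<Rightarrow> real \<times> real"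
    and q :: "'s \<Rightarrow> real^2"
    and l :: 't and c :: 2
  assumes "\<beta> > 0" and "\<epsilon> > 0"
    and "admissible k d \<xi> \<eta>"
    and "quadrature_of_precision \<epsilon> (cell k d \<xi> \<eta>) (F_beta k d \<xi> \<eta> \<beta>) w\<beta> node\<beta>"
    and "quadrature_of_precision \<epsilon> (cell k d \<xi> \<eta>) (F_zero k d \<xi> \<eta> \<beta>) w0 node0"
    and "\<And>j. s j \<in> cell k d \<xi> \<eta>"
    and "\<And>l. t l \<in> cell k d \<xi> \<eta>"
  shows "\<bar>Re ((P_matrix k a d \<xi> \<eta> \<beta> w\<beta> node\<beta> w0 node0 t s *v block_vector q) $ (l, c)) -
          (\<Sum>j\<in>UNIV. K_far k a d \<xi> \<eta> \<beta> (t l) (s j) *v q j) $ c\<bar>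
         \<le> 2 * \<epsilon> * (\<Sum>j\<in>UNIV. \<bar>q j $ 1\<bar> + \<bar>q j $ 2\<bar>)"
proof -
  \<comment> \<open>Both sides reduce to a block matrix whose entries in block row \<open>l\<close>
    have real parts within \<open>2 * \<epsilon>\<close> of the kernel.\<close>
  obtain A where A: "P_matrix k a d \<xi> \<eta> \<beta> w\<beta> node\<beta> w0 node0 t s = block_matrix A"
    and bound: "\<And>j i e. \<bar>Re (A l j $ i $ e) - K_far k a d \<xi> \<eta> \<beta> (t l) (s j) $ i $ e\<bar> \<le> 2 * \<epsilon>"
  proof (cases a)
    case West
    show thesis
      by (rule that) (unfold West P_matrix_West, rule refl, intro quadrature_West assms)
  next
    case East
    show thesis
    proof (rule that)
      show "P_matrix k a d \<xi> \<eta> \<beta> w\<beta> node\<beta> w0 node0 t s = block_matrix (\<lambda>l j. map_matrix cnj (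
         (\<Sum>n\<in>UNIV. w\<beta> n *\<^sub>R F_beta k d \<xi> \<eta> \<beta> (node\<beta> n) (s j) (t l)) +
         (\<Sum>n\<in>UNIV. w0 n *\<^sub>R F_zero k d \<xi> \<eta> \<beta> (node0 n) (s j) (t l))))"
        unfolding East by (rule P_matrix_East)
      show "\<bar>Re (map_matrix cnj (
         (\<Sum>n\<in>UNIV. w\<beta> n *\<^sub>R F_beta k d \<xi> \<eta> \<beta> (node\<beta> n) (s j) (t l)) +
         (\<Sum>n\<in>UNIV. w0 n *\<^sub>R F_zero k d \<xi> \<eta> \<beta> (node0 n) (s j) (t l))) $ i $ e) -
         K_far k a d \<xi> \<eta> \<beta> (t l) (s j) $ i $ e\<bar> \<le> 2 * \<epsilon>" for j i e
        \<comment> \<open>The west estimate is applied with source and target exchanged, which is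
          possible since both lie in the same cell; conjugation leaves real parts unchanged.\<close>
        using quadrature_West[OF assms(1,3-5,6,7), of j l i e] K_far_East[OF assms(1,3,7,6), of l j]
        by (simp add: East map_matrix_def)
    qed
  qed
  \<comment> \<open>Since \<open>q\<close> is real, taking the real part of the product affects only
    the matrix entries.\<close>
  let ?D = "\<lambda>j e. (Re (A l j $ c $ e) - K_far k a d \<xi> \<eta> \<beta> (t l) (s j) $ c $ e) * q j $ e"
  have "Re ((P_matrix k a d \<xi> \<eta> \<beta> w\<beta> node\<beta> w0 node0 t s *v block_vector q) $ (l, c)) -
      (\<Sum>j\<in>UNIV. K_far k a d \<xi> \<eta> \<beta> (t l) (s j) *v q j) $ c = (\<Sum>j\<in>UNIV. \<Sum>e\<in>UNIV. ?D j e)"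
    unfolding A block_matrix_vector_mult
    by (simp add: matrix_vector_mult_def left_diff_distrib sum_subtractf)
  also have "\<bar>\<dots>\<bar> \<le> (\<Sum>j\<in>UNIV. \<Sum>e\<in>UNIV. 2 * \<epsilon> * \<bar>q j $ e\<bar>)"
    by (intro order_trans[OF sum_abs] sum_mono) (auto simp: abs_mult intro!: mult_right_mono bound)
  also have "\<dots> = 2 * \<epsilon> * (\<Sum>j\<in>UNIV. \<bar>q j $ 1\<bar> + \<bar>q j $ 2\<bar>)"
    by (simp add: sum_2 sum_distrib_left distrib_left)
  finally show ?thesis .
qed

end
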